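(* Let $L$ be a non-trivial alternating link. If there exists a reduced alternating diagram $D$ of $L$ such that the generators of the involutory quandle $IQ(L)$ of $L$ corresponding to the arcs in $D$ are pairwise distinct elements of $IQ(L)$, then $IQ(L)$ is not left-orderable.
   Context: Links are tame links in the 3-sphere; a link is non-trivial if it is not a trivial link (unlink). A diagram is reduced if it has no nugatory crossing. A quandle is a non-empty set $Q$ with a binary operation $*$ such that $x*x=x$; for all $x,y$ there is a unique $z$ (denoted $x*^{-1}y$) with $x=z*y$; and $(x*y)*z=(x*z)*(y*z)$. $Q$ is left-orderable if it has a (strict) linear order $<$ such that $x<y$ implies $z*x<z*y$ for all $x,y,z\in Q$. The link quandle $Q(L)$ of an oriented link is the quandle presented by generators the arcs of a diagram and one relation per crossing: if $y$ is the over arc and $x$, $z$ are the incoming and outgoing under arcs, then $z=x*y$ if the crossing is positive and $z=x*^{-1}y$ if it is negative; up to isomorphism it does not depend on the diagram. The involutory quandle $IQ(L)$ is the quotient of $Q(L)$ obtained by imposing the relations $x*^{-1}y=x*y$ for all $x,y$. *)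

theory Defs
  imports "HOL-Analysis.Analysis"
begin

section \<open>Quandles\<close>

record 'a quandle_struct =
  qcarrier :: "'a set"
  qop :: "'a \<Rightarrow> 'a \<Rightarrow> 'a"

definition quandle :: "'a quandle_struct \<Rightarrow> bool" where
  "quandle Q \<longleftrightarrow> qcarrier Q \<noteq> {}
    \<and> (\<forall>x\<in>qcarrier Q. \<forall>y\<in>qcarrier Q. qop Q x y \<in> qcarrier Q)
    \<and> (\<forall>x\<in>qcarrier Q. qop Q x x = x)
    \<and> (\<forall>x\<in>qcarrier Q. \<forall>y\<in>qcarrier Q. \<exists>!z. z \<in> qcarrier Q \<and> x = qop Q z y)
    \<and> (\<forall>x\<in>qcarrier Q. \<forall>y\<in>qcarrier Q. \<forall>z\<in>qcarrier Q.
         qop Q (qop Q x y) z = qop Q (qop Q x z) (qop Q y z))"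

definition qinv :: "'a quandle_struct \<Rightarrow> 'a \<Rightarrow> 'a \<Rightarrow> 'a" where
  "qinv Q x y = (THE z. z \<in> qcarrier Q \<and> x = qop Q z y)"

definition left_orderable :: "'a quandle_struct \<Rightarrow> bool" where
  "left_orderable Q \<longleftrightarrow> (\<exists>r. strict_linear_order_on (qcarrier Q) r \<and>
     (\<forall>x\<in>qcarrier Q. \<forall>y\<in>qcarrier Q. \<forall>z\<in>qcarrier Q.
        (x, y) \<in> r \<longrightarrow> (qop Q z x, qop Q z y) \<in> r))"

definition quotient_quandle ::
    "'a quandle_struct \<Rightarrow> ('a \<times> 'a) set \<Rightarrow> 'a set quandle_struct" where
  "quotient_quandle Q \<theta> =
     \<lparr>qcarrier = qcarrier Q // \<theta>, qop = (\<lambda>X Y. \<Union>x\<in>X. \<Union>y\<in>Y. \<theta> `` {qop Q x y})\<rparr>"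

definition quandle_congruence :: "'a quandle_struct \<Rightarrow> ('a \<times> 'a) set \<Rightarrow> bool" where
  "quandle_congruence Q \<theta> \<longleftrightarrow> equiv (qcarrier Q) \<theta> \<and>
     (\<forall>x x' y y'. (x, x') \<in> \<theta> \<and> (y, y') \<in> \<theta> \<longrightarrow>
        (qop Q x y, qop Q x' y') \<in> \<theta> \<and> (qinv Q x y, qinv Q x' y') \<in> \<theta>)"

definition involutory_congruence :: "'a quandle_struct \<Rightarrow> ('a \<times> 'a) set" where
  "involutory_congruence Q = \<Inter>{\<theta>. quandle_congruence Q \<theta> \<and>
     (\<forall>x\<in>qcarrier Q. \<forall>y\<in>qcarrier Q. (qinv Q x y, qop Q x y) \<in> \<theta>)}"

definition involutory_quotient :: "'a quandle_struct \<Rightarrow> 'a set quandle_struct" where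
  "involutory_quotient Q = quotient_quandle Q (involutory_congruence Q)"

lemma qop_quotient_class:
  assumes "equiv (qcarrier Q) \<theta>"
    and "\<And>x x' y y'. \<lbrakk>(x, x') \<in> \<theta>; (y, y') \<in> \<theta>\<rbrakk> \<Longrightarrow> (qop Q x y, qop Q x' y') \<in> \<theta>"
    and "x \<in> qcarrier Q" "y \<in> qcarrier Q"
  shows "qop (quotient_quandle Q \<theta>) (\<theta> `` {x}) (\<theta> `` {y}) = \<theta> `` {qop Q x y}"
proof -
  have "\<theta> `` {qop Q x' y'} = \<theta> `` {qop Q x y}" if "(x, x') \<in> \<theta>" "(y, y') \<in> \<theta>" for x' y'
    using equiv_class_eq[OF assms(1) assms(2)[OF that]] by simp
  moreover have "(x, x) \<in> \<theta>" "(y, y) \<in> \<theta>"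
    using assms(1,3,4) by (auto simp: equiv_def refl_on_def)
  ultimately have "(\<Union>x'\<in>\<theta> `` {x}. \<Union>y'\<in>\<theta> `` {y}. \<theta> `` {qop Q x' y'}) = \<theta> `` {qop Q x y}"
    by blast
  then show ?thesis
    by (simp add: quotient_quandle_def)
qed

lemma quandle_quotientI:
  assumes eq: "equiv (qcarrier Q) \<theta>" and ne: "qcarrier Q \<noteq> {}"
    and op: "\<And>x x' y y'. \<lbrakk>(x, x') \<in> \<theta>; (y, y') \<in> \<theta>\<rbrakk> \<Longrightarrow> (qop Q x y, qop Q x' y') \<in> \<theta>"
    and i: "\<And>x x' y y'. \<lbrakk>(x, x') \<in> \<theta>; (y, y') \<in> \<theta>\<rbrakk> \<Longrightarrow> (i x y, i x' y') \<in> \<theta>"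
    and idem: "\<And>x. x \<in> qcarrier Q \<Longrightarrow> (qop Q x x, x) \<in> \<theta>"
    and i_op: "\<And>x y. \<lbrakk>x \<in> qcarrier Q; y \<in> qcarrier Q\<rbrakk> \<Longrightarrow> (i (qop Q x y) y, x) \<in> \<theta>"
    and op_i: "\<And>x y. \<lbrakk>x \<in> qcarrier Q; y \<in> qcarrier Q\<rbrakk> \<Longrightarrow> (qop Q (i x y) y, x) \<in> \<theta>"
    and distr: "\<And>x y z. \<lbrakk>x \<in> qcarrier Q; y \<in> qcarrier Q; z \<in> qcarrier Q\<rbrakk>
      \<Longrightarrow> (qop Q (qop Q x y) z, qop Q (qop Q x z) (qop Q y z)) \<in> \<theta>"
  shows "quandle (quotient_quandle Q \<theta>)"
proof -
  let ?C = "qcarrier Q" and ?P = "quotient_quandle Q \<theta>"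
  have refl: "(x, x) \<in> \<theta>" if "x \<in> ?C" for x
    using eq that by (auto simp: equiv_def refl_on_def)
  have sub: "x \<in> ?C" "y \<in> ?C" if "(x, y) \<in> \<theta>" for x y
    using equiv_type[OF eq] that by auto
  have clo: "qop Q x y \<in> ?C" "i x y \<in> ?C" if "x \<in> ?C" "y \<in> ?C" for x y
    using sub(1)[OF op[OF refl refl]] sub(1)[OF i[OF refl refl]] that by blast+
  have cls: "\<theta> `` {x} = \<theta> `` {y} \<longleftrightarrow> (x, y) \<in> \<theta>" if "x \<in> ?C" "y \<in> ?C" for x y
    using eq_equiv_class_iff[OF eq that] .
  have qcl: "qop ?P (\<theta> `` {x}) (\<theta> `` {y}) = \<theta> `` {qop Q x y}" if "x \<in> ?C" "y \<in> ?C" for x y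
    by (rule qop_quotient_class[OF eq op that]) auto
  have car: "qcarrier ?P = (\<lambda>x. \<theta> `` {x}) ` ?C"
    by (auto simp: quotient_quandle_def quotient_def)
  have sy: "(y, x) \<in> \<theta>" if "(x, y) \<in> \<theta>" for x y
    using eq that by (auto simp: equiv_def sym_def)
  have tr: "(x, z) \<in> \<theta>" if "(x, y) \<in> \<theta>" "(y, z) \<in> \<theta>" for x y z
    using eq that by (meson equiv_def transD)
  have canc: "(z, i x y) \<in> \<theta>" if "x \<in> ?C" "y \<in> ?C" "z \<in> ?C" "(x, qop Q z y) \<in> \<theta>" for x y z
    using tr[OF i[OF that(4) refl[OF that(2)]] i_op[OF that(3,2)]] by (rule sy)
  have uniq: "\<exists>!Z. Z \<in> qcarrier ?P \<and> \<theta> `` {x} = qop ?P Z (\<theta> `` {y})"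
    if xy: "x \<in> ?C" "y \<in> ?C" for x y
  proof (rule ex1I[of _ "\<theta> `` {i x y}"])
    show "\<theta> `` {i x y} \<in> qcarrier ?P \<and> \<theta> `` {x} = qop ?P (\<theta> `` {i x y}) (\<theta> `` {y})"
      using xy clo op_i sy by (simp add: car qcl cls)
  next
    fix Z assume "Z \<in> qcarrier ?P \<and> \<theta> `` {x} = qop ?P Z (\<theta> `` {y})"
    then obtain z where z: "z \<in> ?C" "Z = \<theta> `` {z}" and "\<theta> `` {x} = qop ?P Z (\<theta> `` {y})"
      unfolding car by blast
    then have "(x, qop Q z y) \<in> \<theta>"
      using xy clo by (simp add: qcl cls)
    then show "Z = \<theta> `` {i x y}"
      using canc xy clo z by (simp add: cls)
  qed
  show ?thesis
    unfolding quandle_def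
  proof (intro conjI)
    show "\<forall>X\<in>qcarrier ?P. \<forall>Y\<in>qcarrier ?P. \<exists>!Z. Z \<in> qcarrier ?P \<and> X = qop ?P Z Y"
    proof (intro ballI)
      fix X Y assume "X \<in> qcarrier ?P" "Y \<in> qcarrier ?P"
      then obtain x y where "x \<in> ?C" "y \<in> ?C" and XY: "X = \<theta> `` {x}" "Y = \<theta> `` {y}"
        unfolding car by blast
      then show "\<exists>!Z. Z \<in> qcarrier ?P \<and> X = qop ?P Z Y"
        unfolding XY by (intro uniq)
    qed
    show "qcarrier ?P \<noteq> {}"
      using ne by (simp add: car)
    show "\<forall>X\<in>qcarrier ?P. \<forall>Y\<in>qcarrier ?P. qop ?P X Y \<in> qcarrier ?P"
      using clo by (simp add: car qcl)
    show "\<forall>X\<in>qcarrier ?P. qop ?P X X = X"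
      using clo idem by (simp add: car qcl cls)
    show "\<forall>X\<in>qcarrier ?P. \<forall>Y\<in>qcarrier ?P. \<forall>Z\<in>qcarrier ?P.
        qop ?P (qop ?P X Y) Z = qop ?P (qop ?P X Z) (qop ?P Y Z)"
      using clo distr by (simp add: car qcl cls)
  qed
qed

lemma qinv_props:
  assumes "quandle Q" "x \<in> qcarrier Q" "y \<in> qcarrier Q"
  shows "qinv Q x y \<in> qcarrier Q" "qop Q (qinv Q x y) y = x" "qinv Q (qop Q x y) y = x"
proof -
  have ex: "\<exists>!z. z \<in> qcarrier Q \<and> a = qop Q z y" if "a \<in> qcarrier Q" for a
    using assms that by (auto simp: quandle_def)
  show "qinv Q x y \<in> qcarrier Q" "qop Q (qinv Q x y) y = x"
    using theI'[OF ex[OF assms(2)]] by (auto simp: qinv_def)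
  have "qop Q x y \<in> qcarrier Q"
    using assms by (auto simp: quandle_def)
  then show "qinv Q (qop Q x y) y = x"
    unfolding qinv_def using ex assms(2) by (intro the1_equality) auto
qed

lemma involutory_congruence:
  assumes "quandle Q"
  shows "quandle_congruence Q (involutory_congruence Q)"
proof -
  let ?T = "{\<theta>. quandle_congruence Q \<theta> \<and>
    (\<forall>x\<in>qcarrier Q. \<forall>y\<in>qcarrier Q. (qinv Q x y, qop Q x y) \<in> \<theta>)}"
  have clo: "qop Q x y \<in> qcarrier Q" if "x \<in> qcarrier Q" "y \<in> qcarrier Q" for x y
    using assms that by (auto simp: quandle_def)
  have "qcarrier Q \<times> qcarrier Q \<in> ?T"
    using clo qinv_props(1)[OF assms]
    by (auto simp: quandle_congruence_def equiv_def refl_on_def sym_def trans_def)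
  then have ne: "?T \<noteq> {}" and sub: "\<Inter>?T \<subseteq> qcarrier Q \<times> qcarrier Q"
    by blast+
  have T: "equiv (qcarrier Q) \<theta>" "(x, x') \<in> \<theta> \<Longrightarrow> (y, y') \<in> \<theta> \<Longrightarrow>
      (qop Q x y, qop Q x' y') \<in> \<theta> \<and> (qinv Q x y, qinv Q x' y') \<in> \<theta>"
    if "\<theta> \<in> ?T" for \<theta> x x' y y'
    using that unfolding quandle_congruence_def by blast+
  have "equiv (qcarrier Q) (\<Inter>?T)"
  proof (rule equivI)
    show "\<Inter>?T \<subseteq> qcarrier Q \<times> qcarrier Q"
      by (rule sub)
    show "refl_on (qcarrier Q) (\<Inter>?T)"
      using T(1) unfolding equiv_def refl_on_def by blast
    show "sym (\<Inter>?T)"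
      using T(1) by (intro symI InterI) (meson InterD equivE symD)
    show "trans (\<Inter>?T)"
      using T(1) by (intro transI InterI) (meson InterD equivE transD)
  qed
  moreover have "(qop Q x y, qop Q x' y') \<in> \<Inter>?T \<and> (qinv Q x y, qinv Q x' y') \<in> \<Inter>?T"
    if "(x, x') \<in> \<Inter>?T" "(y, y') \<in> \<Inter>?T" for x x' y y'
    using T(2) InterD[OF that(1)] InterD[OF that(2)] by (intro conjI InterI) blast+
  ultimately have "quandle_congruence Q (\<Inter>?T)"
    by (subst quandle_congruence_def) blast
  then show ?thesis
    by (simp only: involutory_congruence_def)
qed

lemma quandle_involutory_quotient:
  assumes "quandle Q"
  shows "quandle (involutory_quotient Q)"
proof -
  let ?\<theta> = "involutory_congruence Q"
  have eq: "equiv (qcarrier Q) ?\<theta>"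
    and c: "\<And>x x' y y'. (x, x') \<in> ?\<theta> \<Longrightarrow> (y, y') \<in> ?\<theta> \<Longrightarrow>
      (qop Q x y, qop Q x' y') \<in> ?\<theta> \<and> (qinv Q x y, qinv Q x' y') \<in> ?\<theta>"
    using involutory_congruence[OF assms] unfolding quandle_congruence_def by blast+
  have r: "(x, y) \<in> ?\<theta>" if "x = y" "y \<in> qcarrier Q" for x y
    using eq that by (auto simp: equiv_def refl_on_def)
  have q: "qcarrier Q \<noteq> {}"
    "\<And>x y. x \<in> qcarrier Q \<Longrightarrow> y \<in> qcarrier Q \<Longrightarrow> qop Q x y \<in> qcarrier Q"
    "\<And>x. x \<in> qcarrier Q \<Longrightarrow> qop Q x x = x"
    "\<And>x y z. x \<in> qcarrier Q \<Longrightarrow> y \<in> qcarrier Q \<Longrightarrow> z \<in> qcarrier Q \<Longrightarrow>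
      qop Q (qop Q x y) z = qop Q (qop Q x z) (qop Q y z)"
    using assms unfolding quandle_def by blast+
  show ?thesis
    unfolding involutory_quotient_def
  proof (rule quandle_quotientI[where i = "qinv Q"])
    fix x y z
    assume x: "x \<in> qcarrier Q"
    show "(qop Q x x, x) \<in> ?\<theta>"
      by (rule r[OF q(3)[OF x] x])
    assume y: "y \<in> qcarrier Q"
    show "(qinv Q (qop Q x y) y, x) \<in> ?\<theta>" "(qop Q (qinv Q x y) y, x) \<in> ?\<theta>"
      by (rule r[OF qinv_props(3)[OF assms x y] x], rule r[OF qinv_props(2)[OF assms x y] x])
    assume z: "z \<in> qcarrier Q"
    show "(qop Q (qop Q x y) z, qop Q (qop Q x z) (qop Q y z)) \<in> ?\<theta>"
      by (intro r q x y z)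
  qed (use eq c q(1) in blast)+
qed


subsection \<open>Presentations\<close>

datatype (gens: 'g) qterm = Gen 'g | Op "'g qterm" "'g qterm" | Inv "'g qterm" "'g qterm"

definition qterms :: "'g set \<Rightarrow> 'g qterm set" where
  "qterms G = {t. gens t \<subseteq> G}"

inductive_set presentation_rel ::
    "'g set \<Rightarrow> ('g qterm \<times> 'g qterm) set \<Rightarrow> ('g qterm \<times> 'g qterm) set"
  for G :: "'g set" and R :: "('g qterm \<times> 'g qterm) set" where
  rel: "\<lbrakk>(s, t) \<in> R; s \<in> qterms G; t \<in> qterms G\<rbrakk> \<Longrightarrow> (s, t) \<in> presentation_rel G R"
| refl: "s \<in> qterms G \<Longrightarrow> (s, s) \<in> presentation_rel G R"
| sym: "(s, t) \<in> presentation_rel G R \<Longrightarrow> (t, s) \<in> presentation_rel G R"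
| trans: "\<lbrakk>(s, t) \<in> presentation_rel G R; (t, u) \<in> presentation_rel G R\<rbrakk>
    \<Longrightarrow> (s, u) \<in> presentation_rel G R"
| Op_cong: "\<lbrakk>(s, s') \<in> presentation_rel G R; (t, t') \<in> presentation_rel G R\<rbrakk>
    \<Longrightarrow> (Op s t, Op s' t') \<in> presentation_rel G R"
| Inv_cong: "\<lbrakk>(s, s') \<in> presentation_rel G R; (t, t') \<in> presentation_rel G R\<rbrakk>
    \<Longrightarrow> (Inv s t, Inv s' t') \<in> presentation_rel G R"
| idem: "s \<in> qterms G \<Longrightarrow> (Op s s, s) \<in> presentation_rel G R"
| Inv_Op: "\<lbrakk>s \<in> qterms G; t \<in> qterms G\<rbrakk> \<Longrightarrow> (Inv (Op s t) t, s) \<in> presentation_rel G R"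
| Op_Inv: "\<lbrakk>s \<in> qterms G; t \<in> qterms G\<rbrakk> \<Longrightarrow> (Op (Inv s t) t, s) \<in> presentation_rel G R"
| distr: "\<lbrakk>s \<in> qterms G; t \<in> qterms G; u \<in> qterms G\<rbrakk>
    \<Longrightarrow> (Op (Op s t) u, Op (Op s u) (Op t u)) \<in> presentation_rel G R"

definition presented_quandle ::
    "'g set \<Rightarrow> ('g qterm \<times> 'g qterm) set \<Rightarrow> 'g qterm set quandle_struct" where
  "presented_quandle G R =
     quotient_quandle \<lparr>qcarrier = qterms G, qop = Op\<rparr> (presentation_rel G R)"

lemma presentation_rel_qterms:
  "(s, t) \<in> presentation_rel G R \<Longrightarrow> s \<in> qterms G \<and> t \<in> qterms G"
  by (induction rule: presentation_rel.induct) (auto simp: qterms_def)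

lemma equiv_presentation_rel: "equiv (qterms G) (presentation_rel G R)"
  unfolding equiv_def refl_on_def sym_def trans_def
  using presentation_rel_qterms[of _ _ G R]
  by (auto intro: presentation_rel.refl presentation_rel.sym presentation_rel.trans)

lemma quandle_presented_quandle:
  assumes "G \<noteq> {}"
  shows "quandle (presented_quandle G R)"
proof -
  from assms obtain g where "g \<in> G" by blast
  then have "Gen g \<in> qterms G"
    by (simp add: qterms_def)
  show ?thesis
    unfolding presented_quandle_def
  proof (rule quandle_quotientI[where i = Inv])
    show "qcarrier \<lparr>qcarrier = qterms G, qop = Op\<rparr> \<noteq> {}"
      using \<open>Gen g \<in> qterms G\<close> by auto
  qed (simp_all only: quandle_struct.simps equiv_presentation_rel presentation_rel.Op_cong
      presentation_rel.Inv_cong presentation_rel.idem presentation_rel.Inv_Op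
      presentation_rel.Op_Inv presentation_rel.distr)
qed


section \<open>Links in the 3-sphere\<close>

text \<open>Euclidean 3-space is \<open>complex \<times> real\<close>: the projection plane times the height.\<close>

type_synonym space = "complex \<times> real"

abbreviation S3 :: "(space \<times> real) set" where
  "S3 \<equiv> sphere 0 1"

text \<open>Inverse stereographic projection from the north pole \<open>(0, 1)\<close>.\<close>

definition inv_stereo :: "space \<Rightarrow> space \<times> real" where
  "inv_stereo p =
     ((2 / ((norm p)\<^sup>2 + 1)) *\<^sub>R p, ((norm p)\<^sup>2 - 1) / ((norm p)\<^sup>2 + 1))"

definition ambient_isotopic :: "(space \<times> real) set \<Rightarrow> (space \<times> real) set \<Rightarrow> bool" where
  "ambient_isotopic A B \<longleftrightarrow> (\<exists>H :: real \<Rightarrow> space \<times> real \<Rightarrow> space \<times> real.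
     continuous_on ({0..1} \<times> S3) (\<lambda>(t, x). H t x)
     \<and> (\<forall>t\<in>{0..1}. \<exists>g. homeomorphism S3 S3 (H t) g)
     \<and> (\<forall>x\<in>S3. H 0 x = x)
     \<and> H 1 ` A = B)"

definition is_link :: "(space \<times> real) set \<Rightarrow> bool" where
  "is_link L \<longleftrightarrow> (\<exists>\<Gamma> :: (real \<Rightarrow> space \<times> real) set. finite \<Gamma> \<and> \<Gamma> \<noteq> {}
     \<and> (\<forall>g\<in>\<Gamma>. simple_path g \<and> pathfinish g = pathstart g \<and> path_image g \<subseteq> S3)
     \<and> pairwise (\<lambda>g h. path_image g \<inter> path_image h = {}) \<Gamma>
     \<and> L = (\<Union>g\<in>\<Gamma>. path_image g))"

text \<open>A link is trivial if it is isotopic to disjoint simple closed curves in a plane.\<close>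

definition trivial_link :: "(space \<times> real) set \<Rightarrow> bool" where
  "trivial_link L \<longleftrightarrow>
     (\<exists>P. is_link P \<and> P \<subseteq> inv_stereo ` {p. snd p = 0} \<and> ambient_isotopic L P)"


subsection \<open>Polygonal links\<close>

text \<open>
  An oriented polygonal link is a finite set of cyclic lists of vertices.
  The closed polygon with vertices \<open>vs\<close> is parametrised over all of \<open>real\<close>, with period
  \<open>length vs\<close>: the vertices are at the integers, and the orientation is that of increasing
  parameter.
\<close>

definition vert :: "space list \<Rightarrow> int \<Rightarrow> space" where
  "vert vs k = vs ! nat (k mod int (length vs))"

definition loop :: "space list \<Rightarrow> real \<Rightarrow> space" where
  "loop vs t = (1 - frac t) *\<^sub>R vert vs \<lfloor>t\<rfloor> + frac t *\<^sub>R vert vs (\<lfloor>t\<rfloor> + 1)"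

definition link_points :: "space list set \<Rightarrow> space set" where
  "link_points D = (\<Union>vs\<in>D. range (loop vs))"

definition polygonal_link :: "space list set \<Rightarrow> bool" where
  "polygonal_link D \<longleftrightarrow> finite D \<and> D \<noteq> {} \<and> [] \<notin> D
     \<and> (\<forall>vs\<in>D. \<forall>ws\<in>D. \<forall>s t. loop vs s = loop ws t \<longrightarrow>
          vs = ws \<and> (\<exists>k::int. t = s + of_int k * real (length vs)))"

definition tame_link :: "(space \<times> real) set \<Rightarrow> bool" where
  "tame_link L \<longleftrightarrow>
     is_link L \<and> (\<exists>D. polygonal_link D \<and> ambient_isotopic L (inv_stereo ` link_points D))"


section \<open>Diagrams\<close>

text \<open>
  A diagram is an oriented polygonal link whose projection \<open>fst\<close> to the plane is regular. A crossing
  is given by the two points \<open>u\<close> (under) and \<open>v\<close> (over) of the link that lie above it.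
\<close>

definition crossing :: "space list set \<Rightarrow> space \<Rightarrow> space \<Rightarrow> bool" where
  "crossing D u v \<longleftrightarrow> u \<in> link_points D \<and> v \<in> link_points D \<and> fst u = fst v \<and> snd u < snd v"

definition under_points :: "space list set \<Rightarrow> space set" where
  "under_points D = {u. \<exists>v. crossing D u v}"

definition over_points :: "space list set \<Rightarrow> space set" where
  "over_points D = {v. \<exists>u. crossing D u v}"

text \<open>The direction of the projected edge that contains the parameter \<open>t\<close>.\<close>

definition dir :: "space list \<Rightarrow> real \<Rightarrow> complex" where
  "dir vs t = fst (vert vs (\<lfloor>t\<rfloor> + 1)) - fst (vert vs \<lfloor>t\<rfloor>)"

text \<open>\<open>Im (cnj a * b)\<close> is the determinant of the plane vectors \<open>a\<close>, \<open>b\<close>.\<close>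

definition regular_diagram :: "space list set \<Rightarrow> bool" where
  "regular_diagram D \<longleftrightarrow> polygonal_link D
     \<and> (\<forall>p\<in>link_points D. \<forall>q\<in>link_points D. \<forall>r\<in>link_points D.
          fst p = fst q \<and> fst q = fst r \<longrightarrow> p = q \<or> q = r \<or> p = r)
     \<and> (\<forall>vs\<in>D. \<forall>ws\<in>D. \<forall>s t. crossing D (loop vs s) (loop ws t) \<longrightarrow>
          s \<notin> \<int> \<and> t \<notin> \<int> \<and> Im (cnj (dir vs s) * dir ws t) \<noteq> 0)"

definition diagram_of :: "space list set \<Rightarrow> (space \<times> real) set \<Rightarrow> bool" where
  "diagram_of D L \<longleftrightarrow> regular_diagram D \<and> ambient_isotopic L (inv_stereo ` link_points D)"

definition alternating_diagram :: "space list set \<Rightarrow> bool" where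
  "alternating_diagram D \<longleftrightarrow> (\<forall>vs\<in>D. \<forall>s t. s < t
     \<and> loop vs s \<in> under_points D \<union> over_points D
     \<and> loop vs t \<in> under_points D \<union> over_points D
     \<and> (\<forall>r. s < r \<and> r < t \<longrightarrow> loop vs r \<notin> under_points D \<union> over_points D)
     \<longrightarrow> (loop vs s \<in> under_points D \<longleftrightarrow> loop vs t \<in> over_points D))"

definition alternating_link :: "(space \<times> real) set \<Rightarrow> bool" where
  "alternating_link L \<longleftrightarrow> tame_link L \<and> (\<exists>D. diagram_of D L \<and> alternating_diagram D)"

text \<open>
  A crossing is nugatory if two opposite ones of the four regions around it are the same region of
  the diagram; equivalently, some simple closed curve in the plane meets the diagram in the crossing
  only, transversally. With \<open>a\<close>, \<open>b\<close> the directions of the two strands, the four corners lie in the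
  directions \<open>a + b\<close>, \<open>a - b\<close> and their negatives.
\<close>

definition nugatory :: "space list set \<Rightarrow> space \<Rightarrow> space \<Rightarrow> bool" where
  "nugatory D u v \<longleftrightarrow> (\<exists>vs\<in>D. \<exists>ws\<in>D. \<exists>s t.
     u = loop vs s \<and> v = loop ws t \<and> crossing D u v \<and>
     (\<exists>w\<in>{dir vs s + dir ws t, dir vs s - dir ws t}.
        \<forall>\<^sub>F \<epsilon> in at_right 0.
          connected_component (- fst ` link_points D) (fst u + \<epsilon> *\<^sub>R w) (fst u - \<epsilon> *\<^sub>R w)))"

definition reduced_diagram :: "space list set \<Rightarrow> bool" where
  "reduced_diagram D \<longleftrightarrow> (\<forall>u v. crossing D u v \<longrightarrow> \<not> nugatory D u v)"

text \<open>The arcs are the pieces into which the undercrossings cut the link.\<close>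

definition arcs :: "space list set \<Rightarrow> space set set" where
  "arcs D = components (link_points D - under_points D)"


section \<open>Link quandles\<close>

text \<open>
  The over arc is \<open>y\<close>, the incoming and outgoing under arcs are \<open>x\<close> and \<open>z\<close>. A crossing is
  positive if the over direction followed by the under direction is a positive basis of the plane.
\<close>

definition crossing_relations ::
    "space list set \<Rightarrow> (space set qterm \<times> space set qterm) set" where
  "crossing_relations D =
     {(Gen z, if Im (cnj (dir ws t) * dir vs s) > 0 then Op (Gen x) (Gen y) else Inv (Gen x) (Gen y))
      | x y z vs ws s t.
        vs \<in> D \<and> ws \<in> D \<and> crossing D (loop vs s) (loop ws t)
        \<and> x \<in> arcs D \<and> y \<in> arcs D \<and> z \<in> arcs D
        \<and> loop ws t \<in> y
        \<and> (\<forall>\<^sub>F \<epsilon> in at_right 0. loop vs (s - \<epsilon>) \<in> x)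
        \<and> (\<forall>\<^sub>F \<epsilon> in at_right 0. loop vs (s + \<epsilon>) \<in> z)}"

definition link_quandle :: "space list set \<Rightarrow> space set qterm set quandle_struct" where
  "link_quandle D = presented_quandle (arcs D) (crossing_relations D)"

definition IQ :: "space list set \<Rightarrow> space set qterm set set quandle_struct" where
  "IQ D = involutory_quotient (link_quandle D)"

definition IQ_generator :: "space list set \<Rightarrow> space set \<Rightarrow> space set qterm set set" where
  "IQ_generator D x = involutory_congruence (link_quandle D) ``
     {presentation_rel (arcs D) (crossing_relations D) `` {Gen x}}"

end

theory Submission
  imports Defs
begin

text \<open>
  In an involutory quandle a crossing with over arc \<open>y\<close> and under arcs \<open>x\<close>, \<open>z\<close> means \<open>x * y = z\<close> and
  \<open>z * y = x\<close>. A left order forces \<open>x < y < z\<close>, \<open>z < y < x\<close> or \<open>x = y = z\<close>. Take \<open>y\<close> least among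
  the arcs that contain an overcrossing. In an alternating diagram \<open>x\<close> and \<open>z\<close> are of this kind, too,
  hence \<open>x = y = z\<close>, and by the distinctness of the generators the three arcs coincide. Then the
  component of this arc has no other crossing, is projected to a figure eight, and its crossing is
  nugatory. If there are no crossings at all, the link is a graph over its projection and therefore
  trivial.
\<close>

section \<open>Left orders and the involutory quandle\<close>

text \<open>Only an arc with an overcrossing is the over arc of some crossing, so minimality of any
  other arc, such as a whole component without crossings, would say nothing. The minimum exists
  because a regular diagram has finitely many crossings. The order lives on \<open>IQ D\<close> and
  yields equality of generators only; their distinctness turns this into equality of arcs as point
  sets. In an alternating diagram the stretch from one undercrossing to the next passes exactly one
  overcrossing. If the arcs entering and leaving an undercrossing coincide, the last overcrossing
  before it and the first one after it are the same point, so one turn of the component is used up;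
  if the over arc coincides with them too, this point is the one above the undercrossing. Hence the
  figure eight. Other components may lie inside or around its lobes, so opposite corners have to be
  joined in the complement of the whole diagram. Triviality asks for an isotopy of the whole sphere:
  a vertical shear of space is carried over by stereographic projection, and the point at infinity
  needs separate care.\<close>

lemma left_order_involutory_triple:
  assumes Q: "quandle Q" and r: "strict_linear_order_on (qcarrier Q) r"
    and mono: "\<forall>x\<in>qcarrier Q. \<forall>y\<in>qcarrier Q. \<forall>z\<in>qcarrier Q.
        (x, y) \<in> r \<longrightarrow> (qop Q z x, qop Q z y) \<in> r"
    and c: "x \<in> qcarrier Q" "y \<in> qcarrier Q" "z \<in> qcarrier Q"
    and xz: "qop Q x y = z" and zx: "qop Q z y = x"
  shows "x = y \<and> z = y \<or> (x, y) \<in> r \<or> (z, y) \<in> r"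
proof -
  have idem: "qop Q a a = a" if "a \<in> qcarrier Q" for a
    using Q that by (auto simp: quandle_def)
  have tot: "a = b \<or> (a, b) \<in> r \<or> (b, a) \<in> r" if "a \<in> qcarrier Q" "b \<in> qcarrier Q" for a b
    using r that by (auto simp: strict_linear_order_on_def total_on_def)
  have asym: "\<not> ((a, b) \<in> r \<and> (b, a) \<in> r)" for a b
    using r by (auto simp: strict_linear_order_on_def irrefl_def dest: transD)
  show ?thesis
  proof (cases "x = y \<or> z = y")
    case True
    then show ?thesis using idem[OF c(2)] xz zx by auto
  next
    case False
    \<comment> \<open>Left multiplication of \<open>y < x\<close> by \<open>x\<close> gives
      \<open>z = x * y < x * x = x\<close>; symmetrically \<open>y < z\<close> gives
      \<open>x < z\<close>. So \<open>x\<close> and \<open>z\<close> cannot both lie above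
      \<open>y\<close>, which is all that a minimal \<open>y\<close> has to contradict.\<close>
    have "(z, x) \<in> r" if "(y, x) \<in> r"
      using mono c that idem[OF c(1)] xz by metis
    moreover have "(x, z) \<in> r" if "(y, z) \<in> r"
      using mono c that idem[OF c(3)] zx by metis
    ultimately show ?thesis
      using False tot[OF c(1,2)] tot[OF c(3,2)] asym by blast
  qed
qed

text \<open>The congruence identifies \<open>qinv Q (qop Q a b) b\<close>, which is
  \<open>a\<close>, with \<open>qop Q (qop Q a b) b\<close>. So the right action of every class is
  an involution.\<close>

lemma involutory_quotient_op:
  assumes Q: "quandle Q" and c: "a \<in> qcarrier Q" "b \<in> qcarrier Q"
    and \<theta>: "\<theta> = involutory_congruence Q"
  shows "qop (involutory_quotient Q) (\<theta> `` {a}) (\<theta> `` {b}) = \<theta> `` {qop Q a b}"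
    and "qop (involutory_quotient Q) (\<theta> `` {qop Q a b}) (\<theta> `` {b}) = \<theta> `` {a}"
proof -
  have eq: "equiv (qcarrier Q) \<theta>"
    and cong: "\<And>x x' y y'. (x, x') \<in> \<theta> \<Longrightarrow> (y, y') \<in> \<theta> \<Longrightarrow> (qop Q x y, qop Q x' y') \<in> \<theta>"
    using involutory_congruence[OF Q] unfolding quandle_congruence_def \<theta> by blast+
  have op: "qop (involutory_quotient Q) (\<theta> `` {x}) (\<theta> `` {y}) = \<theta> `` {qop Q x y}"
    if "x \<in> qcarrier Q" "y \<in> qcarrier Q" for x y
    unfolding involutory_quotient_def \<theta>[symmetric] by (rule qop_quotient_class[OF eq cong that])
  then show "qop (involutory_quotient Q) (\<theta> `` {a}) (\<theta> `` {b}) = \<theta> `` {qop Q a b}"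
    using c by blast
  have ab: "qop Q a b \<in> qcarrier Q"
    using Q c by (auto simp: quandle_def)
  have "(qinv Q (qop Q a b) b, qop Q (qop Q a b) b) \<in> \<theta>"
    using ab c(2) unfolding \<theta> involutory_congruence_def by blast
  then have "\<theta> `` {a} = \<theta> `` {qop Q (qop Q a b) b}"
    using equiv_class_eq[OF eq] by (simp add: qinv_props(3)[OF Q c])
  then show "qop (involutory_quotient Q) (\<theta> `` {qop Q a b}) (\<theta> `` {b}) = \<theta> `` {a}"
    using op[OF ab c(2)] by simp
qed

lemma IQ_generator_carrier:
  assumes "x \<in> arcs D"
  shows "IQ_generator D x \<in> qcarrier (IQ D)"
  using assms
  by (auto simp: IQ_def IQ_generator_def involutory_quotient_def quotient_quandle_def
      link_quandle_def presented_quandle_def qterms_def intro!: quotientI)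

text \<open>The sign of the crossing disappears: each sign gives one of the two equations in the
  link quandle, and the involution supplies the other.\<close>

lemma IQ_crossing_relation:
  assumes xyz: "x \<in> arcs D" "y \<in> arcs D" "z \<in> arcs D"
    and rel: "(Gen z, if b then Op (Gen x) (Gen y) else Inv (Gen x) (Gen y)) \<in> crossing_relations D"
  shows "qop (IQ D) (IQ_generator D x) (IQ_generator D y) = IQ_generator D z"
    and "qop (IQ D) (IQ_generator D z) (IQ_generator D y) = IQ_generator D x"
proof -
  define \<rho> where "\<rho> = presentation_rel (arcs D) (crossing_relations D)"
  let ?Q = "link_quandle D" and ?\<theta> = "involutory_congruence (link_quandle D)"
  have Q: "quandle ?Q"
    unfolding link_quandle_def using xyz by (intro quandle_presented_quandle) auto
  have eq: "equiv (qterms (arcs D)) \<rho>"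
    unfolding \<rho>_def by (rule equiv_presentation_rel)
  have q: "Gen x \<in> qterms (arcs D)" "Gen y \<in> qterms (arcs D)" "Gen z \<in> qterms (arcs D)"
      "Op (Gen x) (Gen y) \<in> qterms (arcs D)" "Inv (Gen x) (Gen y) \<in> qterms (arcs D)"
    using xyz by (auto simp: qterms_def)
  have op: "qop ?Q (\<rho> `` {s}) (\<rho> `` {t}) = \<rho> `` {Op s t}"
    if "s \<in> qterms (arcs D)" "t \<in> qterms (arcs D)" for s t
  proof -
    let ?P = "\<lparr>qcarrier = qterms (arcs D), qop = Op\<rparr>"
    have "qop (quotient_quandle ?P \<rho>) (\<rho> `` {s}) (\<rho> `` {t}) = \<rho> `` {qop ?P s t}"
      by (rule qop_quotient_class)
        (use eq that in \<open>auto simp: \<rho>_def intro: presentation_rel.Op_cong\<close>)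
    then show ?thesis
      by (simp add: link_quandle_def presented_quandle_def \<rho>_def)
  qed
  have car: "\<rho> `` {s} \<in> qcarrier ?Q" if "s \<in> qterms (arcs D)" for s
    using that by (auto simp: link_quandle_def presented_quandle_def quotient_quandle_def \<rho>_def
        intro!: quotientI)
  have gen: "IQ_generator D w = ?\<theta> `` {\<rho> `` {Gen w}}" for w
    by (simp add: IQ_generator_def \<rho>_def)
  show "qop (IQ D) (IQ_generator D x) (IQ_generator D y) = IQ_generator D z"
    "qop (IQ D) (IQ_generator D z) (IQ_generator D y) = IQ_generator D x"
  proof (atomize (full), cases b)
    case True
    then have "(Gen z, Op (Gen x) (Gen y)) \<in> \<rho>"
      using rel q unfolding \<rho>_def by (auto intro: presentation_rel.rel)
    then have "qop ?Q (\<rho> `` {Gen x}) (\<rho> `` {Gen y}) = \<rho> `` {Gen z}"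
      using equiv_class_eq[OF eq] op[OF q(1,2)] by simp
    then show "qop (IQ D) (IQ_generator D x) (IQ_generator D y) = IQ_generator D z \<and>
       qop (IQ D) (IQ_generator D z) (IQ_generator D y) = IQ_generator D x"
      using involutory_quotient_op[OF Q car[OF q(1)] car[OF q(2)] HOL.refl]
      by (simp add: IQ_def gen)
  next
    case False
    \<comment> \<open>At a negative crossing \<open>z * y = x\<close> holds before passing to the
      involutory quotient, so \<open>x\<close> and \<open>z\<close> exchange their roles.\<close>
    have i: "(Gen z, Inv (Gen x) (Gen y)) \<in> \<rho>"
      using False rel q unfolding \<rho>_def by (auto intro: presentation_rel.rel)
    have "(Gen y, Gen y) \<in> \<rho>"
      using q unfolding \<rho>_def by (blast intro: presentation_rel.refl)
    then have "(Op (Gen z) (Gen y), Gen x) \<in> \<rho>"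
      using i presentation_rel.Op_Inv[OF q(1,2)] unfolding \<rho>_def
      by (blast intro: presentation_rel.trans presentation_rel.Op_cong)
    then have "qop ?Q (\<rho> `` {Gen z}) (\<rho> `` {Gen y}) = \<rho> `` {Gen x}"
      using equiv_class_eq[OF eq] op[OF q(3,2)] by simp
    then show "qop (IQ D) (IQ_generator D x) (IQ_generator D y) = IQ_generator D z \<and>
       qop (IQ D) (IQ_generator D z) (IQ_generator D y) = IQ_generator D x"
      using involutory_quotient_op[OF Q car[OF q(3)] car[OF q(2)] HOL.refl]
      by (simp add: IQ_def gen)
  qed
qed

lemma quandle_IQ: "arcs D \<noteq> {} \<Longrightarrow> quandle (IQ D)"
  unfolding IQ_def link_quandle_def by (intro quandle_involutory_quotient quandle_presented_quandle)

section \<open>Polygonal loops and their crossings\<close>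

lemma vert_add_length: "vert vs (k + i * int (length vs)) = vert vs k"
  by (simp add: vert_def)

lemma loop_periodic: "loop vs (t + of_int k * real (length vs)) = loop vs t"
proof -
  have "t + of_int k * real (length vs) = t + of_int (k * int (length vs))"
    by simp
  moreover have "loop vs (t + of_int (k * int (length vs))) = loop vs t"
    using vert_add_length[of vs "\<lfloor>t\<rfloor>" k] vert_add_length[of vs "\<lfloor>t\<rfloor> + 1" k]
    by (simp add: loop_def frac_def add_ac del: of_int_mult of_int_of_nat_eq)
  ultimately show ?thesis by metis
qed

text \<open>The right end is included although the floor jumps there: both edge formulas give the
  common vertex. Closed edges are needed to glue continuity.\<close>

lemma loop_edge:
  assumes "of_int k \<le> t" "t \<le> of_int k + 1"
  shows "loop vs t = (1 - (t - of_int k)) *\<^sub>R vert vs k + (t - of_int k) *\<^sub>R vert vs (k + 1)"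
proof (cases "t = of_int k + 1")
  case True
  then have "t = of_int (k + 1)" by simp
  then show ?thesis unfolding loop_def by simp
next
  case False
  then have "\<lfloor>t\<rfloor> = k"
    using assms by (intro floor_unique) auto
  then show ?thesis by (simp add: loop_def frac_def)
qed

lemma continuous_on_loop: "continuous_on S (loop vs)"
proof -
  have edge: "continuous_on {of_int k..of_int k + 1} (loop vs)" for k
    by (rule continuous_on_eq[OF _ loop_edge[symmetric]]) (auto intro!: continuous_intros)
  have "isCont (loop vs) t" for t
  proof -
    let ?k = "\<lfloor>t\<rfloor>"
    have "continuous_on ({of_int (?k - 1)..of_int ?k} \<union> {of_int ?k..of_int ?k + 1}) (loop vs)"
      using edge[of "?k - 1"] edge[of ?k] by (intro continuous_on_closed_Un) auto
    then have "continuous_on {of_int (?k - 1)..of_int ?k + 1} (loop vs)"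
      by (simp add: ivl_disj_un_two_touch)
    moreover have "t \<in> interior {of_int (?k - 1)..of_int ?k + 1}"
      by (simp add: interior_atLeastAtMost_real) linarith
    ultimately show ?thesis
      by (rule continuous_on_interior)
  qed
  then show ?thesis
    by (simp add: continuous_at_imp_continuous_on)
qed

lemma fst_loop_linear:
  assumes "t \<notin> \<int>"
  obtains \<eta> where "\<eta> > 0"
    "\<And>h. \<bar>h\<bar> \<le> \<eta> \<Longrightarrow> fst (loop vs (t + h)) = fst (loop vs t) + h *\<^sub>R dir vs t"
proof
  \<comment> \<open>\<open>?e\<close> is the distance from \<open>t\<close> to the nearest integer,
    so \<open>t + h\<close> stays on the edge of \<open>t\<close>.\<close>
  let ?k = "\<lfloor>t\<rfloor>" and ?e = "min (frac t) (1 - frac t)"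
  show "?e > 0"
    using assms by (simp add: frac_gt_0_iff frac_lt_1)
  fix h :: real assume h: "\<bar>h\<bar> \<le> ?e"
  then have "of_int ?k \<le> t + h" "t + h \<le> of_int ?k + 1"
    unfolding frac_def by linarith+
  note th = loop_edge[OF this, of vs]
  have t: "loop vs t = (1 - (t - of_int ?k)) *\<^sub>R vert vs ?k + (t - of_int ?k) *\<^sub>R vert vs (?k + 1)"
    by (rule loop_edge) auto
  show "fst (loop vs (t + h)) = fst (loop vs t) + h *\<^sub>R dir vs t"
    unfolding th t by (simp add: dir_def algebra_simps)
qed

lemma range_loop_period:
  assumes "vs \<noteq> []"
  shows "range (loop vs) = loop vs ` {a..<a + real (length vs)}"
proof -
  let ?n = "real (length vs)"
  have n: "?n > 0" using assms by simp
  have "loop vs t \<in> loop vs ` {a..<a + ?n}" for t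
  proof -
    let ?k = "- \<lfloor>(t - a) / ?n\<rfloor>"
    have "of_int \<lfloor>(t - a) / ?n\<rfloor> * ?n \<le> t - a" "t - a < (of_int \<lfloor>(t - a) / ?n\<rfloor> + 1) * ?n"
      using n by (simp_all flip: pos_le_divide_eq pos_divide_less_eq)
    then have "t + of_int ?k * ?n \<in> {a..<a + ?n}"
      by (simp add: algebra_simps)
    then show ?thesis
      by (rule rev_image_eqI) (simp only: loop_periodic)
  qed
  then show ?thesis by auto
qed

lemma range_loop_cbox:
  assumes "vs \<noteq> []"
  shows "range (loop vs) = loop vs ` {a..a + real (length vs)}"
proof
  show "range (loop vs) \<subseteq> loop vs ` {a..a + real (length vs)}"
    unfolding range_loop_period[OF assms, of a] by auto
qed auto

lemma compact_range_loop: "vs \<noteq> [] \<Longrightarrow> compact (range (loop vs))"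
  using range_loop_cbox[of vs 0]
  by (simp add: compact_continuous_image[OF continuous_on_loop])

lemma compact_link_points: "polygonal_link D \<Longrightarrow> compact (link_points D)"
  unfolding link_points_def polygonal_link_def
  by (intro compact_UN) (auto intro: compact_range_loop)

lemma loop_eqD:
  assumes "polygonal_link D" "vs \<in> D" "ws \<in> D" "loop vs s = loop ws t"
  shows "vs = ws" "\<exists>k::int. t = s + of_int k * real (length vs)"
  using assms unfolding polygonal_link_def by blast+

lemma loop_inj:
  assumes D: "polygonal_link D" "vs \<in> D" and eq: "loop vs s = loop vs t"
    and less: "\<bar>s - t\<bar> < real (length vs)"
  shows "s = t"
proof -
  obtain k :: int where k: "t = s + of_int k * real (length vs)"
    using loop_eqD(2)[OF D(1,2,2) eq] by blast
  then have "\<bar>of_int k\<bar> * real (length vs) < 1 * real (length vs)"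
    using less by (simp add: abs_mult)
  then have "\<bar>real_of_int k\<bar> < 1"
    using less by (subst (asm) mult_less_cancel_right_pos) auto
  then have "k = 0" by linarith
  with k show ?thesis by simp
qed

text \<open>There are finitely many pairs of edges, and two edges that cross transversally have only
  one point in common in the projection. \<open>P e\<close> collects the crossings on the pair
  \<open>e\<close>.\<close>

lemma finite_crossings:
  assumes "regular_diagram D"
  shows "finite {(u, v). crossing D u v}"
proof -
  have pl: "polygonal_link D" and transv: "\<And>vs ws s t. \<lbrakk>vs \<in> D; ws \<in> D;
      crossing D (loop vs s) (loop ws t)\<rbrakk> \<Longrightarrow> Im (cnj (dir vs s) * dir ws t) \<noteq> 0"
    using assms unfolding regular_diagram_def by blast+
  then have fin: "finite D" and ne: "\<And>vs. vs \<in> D \<Longrightarrow> vs \<noteq> []"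
    unfolding polygonal_link_def by blast+
  define E where "E = (\<Union>vs\<in>D. \<Union>ws\<in>D. \<Union>i\<in>{0..<int (length vs)}. \<Union>j\<in>{0..<int (length ws)}. {(vs, i, ws, j)})"
  define P where "P = (\<lambda>(vs, i, ws, j). {(u, v). crossing D u v \<and> vs \<in> D \<and> ws \<in> D \<and>
    (\<exists>s t. \<lfloor>s\<rfloor> = i \<and> \<lfloor>t\<rfloor> = j \<and> u = loop vs s \<and> v = loop ws t)})"
  have edge: "fst (loop xs t) = fst (loop xs s) + (t - s) *\<^sub>R dir xs s" if "\<lfloor>s\<rfloor> = \<lfloor>t\<rfloor>" for xs s t
    using that by (simp add: loop_def dir_def frac_def algebra_simps)
  have "finite E"
    unfolding E_def using fin by auto
  moreover have "finite (P e)" if "e \<in> E" for e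
  proof -
    obtain vs i ws j where e: "e = (vs, i, ws, j)" by (metis prod_cases4)
    have "c = c'" if c: "c \<in> P e" and c': "c' \<in> P e" for c c'
    proof -
      obtain s t where st: "\<lfloor>s\<rfloor> = i" "\<lfloor>t\<rfloor> = j" "c = (loop vs s, loop ws t)"
        and D: "vs \<in> D" "ws \<in> D" and cr: "crossing D (loop vs s) (loop ws t)"
        using c unfolding P_def e by auto
      obtain s' t' where st': "\<lfloor>s'\<rfloor> = i" "\<lfloor>t'\<rfloor> = j" "c' = (loop vs s', loop ws t')"
        and cr': "crossing D (loop vs s') (loop ws t')"
        using c' unfolding P_def e by auto
      let ?a = "dir vs s" and ?b = "dir ws t"
      have "(s' - s) *\<^sub>R ?a = (t' - t) *\<^sub>R ?b"
        using cr cr' edge[of s s' vs] edge[of t t' ws] st st' by (simp add: crossing_def)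
      then have "(s' - s) * Re ?a = (t' - t) * Re ?b" "(s' - s) * Im ?a = (t' - t) * Im ?b"
        by (metis complex_scaleR scaleR_complex.simps)+
      then have "(s' - s) * (Re ?a * Im ?b - Im ?a * Re ?b) = 0"
        "(t' - t) * (Re ?a * Im ?b - Im ?a * Re ?b) = 0" by algebra+
      moreover have "Re ?a * Im ?b - Im ?a * Re ?b \<noteq> 0"
        using transv[OF D cr] by simp
      ultimately show "c = c'"
        using st st' by simp
    qed
    then have "P e = {} \<or> (\<exists>c. P e = {c})"
      by blast
    then show ?thesis
      by (metis finite.emptyI finite_insert)
  qed
  moreover have "{(u, v). crossing D u v} \<subseteq> (\<Union>e\<in>E. P e)"
  proof clarify
    fix u v assume cr: "crossing D u v"
    then obtain vs ws where D: "vs \<in> D" "ws \<in> D" and "u \<in> range (loop vs)" "v \<in> range (loop ws)"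
      unfolding crossing_def link_points_def by blast
    then obtain s t where "s \<in> {0..<0 + real (length vs)}" "u = loop vs s"
        "t \<in> {0..<0 + real (length ws)}" "v = loop ws t"
      using range_loop_period[OF ne, of vs 0] range_loop_period[OF ne, of ws 0] by blast
    moreover from this have "(vs, \<lfloor>s\<rfloor>, ws, \<lfloor>t\<rfloor>) \<in> E"
      using D unfolding E_def by (simp add: floor_less_iff)
    ultimately show "(u, v) \<in> (\<Union>e\<in>E. P e)"
      using cr D unfolding P_def by (intro UN_I[of "(vs, \<lfloor>s\<rfloor>, ws, \<lfloor>t\<rfloor>)"]) auto
  qed
  ultimately show ?thesis
    by (meson finite_UN_I finite_subset)
qed

lemma finite_under_points: "regular_diagram D \<Longrightarrow> finite (under_points D)"
  and finite_over_points: "regular_diagram D \<Longrightarrow> finite (over_points D)"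
  using finite_imageI[OF finite_crossings, of D fst] finite_imageI[OF finite_crossings, of D snd]
  by (force simp: under_points_def over_points_def image_def elim: finite_subset[rotated])+

text \<open>A point that is both would lie between two others with the same projection, a triple
  point.\<close>

lemma under_over_disjoint:
  assumes "regular_diagram D" "p \<in> under_points D"
  shows "p \<notin> over_points D"
proof
  assume "p \<in> over_points D"
  then obtain u v where "crossing D u p" "crossing D p v"
    using assms(2) by (auto simp: under_points_def over_points_def)
  then have "u \<in> link_points D" "p \<in> link_points D" "v \<in> link_points D"
    "fst u = fst p \<and> fst p = fst v" "u \<noteq> p" "p \<noteq> v" "u \<noteq> v"
    by (auto simp: crossing_def)
  then show False
    using assms(1) unfolding regular_diagram_def by blast
qed

text \<open>Working with parameters instead of points replaces the cyclic order along a component by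
  the order of \<open>real\<close>; the set is periodic in return.\<close>

definition crossing_params :: "space list set \<Rightarrow> space list \<Rightarrow> real set" where
  "crossing_params D vs = {t. loop vs t \<in> under_points D \<union> over_points D}"

lemma crossing_params_periodic:
  "t + real (length vs) \<in> crossing_params D vs \<longleftrightarrow> t \<in> crossing_params D vs"
  "t - real (length vs) \<in> crossing_params D vs \<longleftrightarrow> t \<in> crossing_params D vs"
  using loop_periodic[of vs t 1] loop_periodic[of vs t "-1"] by (simp_all add: crossing_params_def)

lemma finite_crossing_params:
  assumes D: "regular_diagram D" "vs \<in> D" and I: "\<And>s t. s \<in> I \<Longrightarrow> t \<in> I \<Longrightarrow> \<bar>s - t\<bar> < real (length vs)"
  shows "finite (crossing_params D vs \<inter> I)"
proof -
  have "inj_on (loop vs) I"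
    using loop_inj[OF _ D(2)] I D(1) by (auto simp: inj_on_def regular_diagram_def)
  moreover have "finite (under_points D \<union> over_points D)"
    using D(1) by (simp add: finite_under_points finite_over_points)
  ultimately show ?thesis
    using finite_vimage_IntI unfolding crossing_params_def vimage_def by blast
qed

lemma next_crossing_param:
  assumes D: "regular_diagram D" "vs \<in> D" and s: "s \<in> crossing_params D vs"
  obtains r where "r \<in> crossing_params D vs" "s < r" "r \<le> s + real (length vs)"
    "\<And>q. \<lbrakk>s < q; q < r\<rbrakk> \<Longrightarrow> q \<notin> crossing_params D vs"
proof -
  let ?n = "real (length vs)" and ?X = "crossing_params D vs"
  let ?F = "?X \<inter> {s<..s + ?n}"
  have "vs \<noteq> []" using D by (auto simp: regular_diagram_def polygonal_link_def)
  \<comment> \<open>After a full turn the crossing itself comes back, so a next one exists even if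
    it is the only one on the component. This is why \<open>r \<le> s + real (length vs)\<close> is
    not strict.\<close>
  then have "s + ?n \<in> ?F" using s by (simp add: crossing_params_periodic)
  moreover have "finite ?F" by (rule finite_crossing_params[OF D]) auto
  ultimately have F: "finite ?F" "?F \<noteq> {}" by blast+
  show thesis
  proof (rule that[of "Min ?F"])
    show "Min ?F \<in> ?X" "s < Min ?F" "Min ?F \<le> s + ?n"
      using Min_in[OF F] by auto
    fix q assume "s < q" "q < Min ?F"
    then show "q \<notin> ?X"
      using Min_le[OF F(1), of q] \<open>Min ?F \<le> s + ?n\<close> by fastforce
  qed
qed

lemma previous_crossing_param:
  assumes D: "regular_diagram D" "vs \<in> D" and s: "s \<in> crossing_params D vs"
  obtains r where "r \<in> crossing_params D vs" "r < s" "s - real (length vs) \<le> r"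
    "\<And>q. \<lbrakk>r < q; q < s\<rbrakk> \<Longrightarrow> q \<notin> crossing_params D vs"
proof -
  let ?n = "real (length vs)" and ?X = "crossing_params D vs"
  let ?F = "?X \<inter> {s - ?n..<s}"
  have "vs \<noteq> []" using D by (auto simp: regular_diagram_def polygonal_link_def)
  then have "s - ?n \<in> ?F" using s by (simp add: crossing_params_periodic)
  moreover have "finite ?F" by (rule finite_crossing_params[OF D]) auto
  ultimately have F: "finite ?F" "?F \<noteq> {}" by blast+
  show thesis
  proof (rule that[of "Max ?F"])
    show "Max ?F \<in> ?X" "Max ?F < s" "s - ?n \<le> Max ?F"
      using Max_in[OF F] by auto
    fix q assume "Max ?F < q" "q < s"
    then show "q \<notin> ?X"
      using Max_ge[OF F(1), of q] \<open>s - ?n \<le> Max ?F\<close> by fastforce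
  qed
qed

section \<open>A component with a single crossing\<close>

lemma plane_coordinates_unique:
  fixes a b :: complex
  assumes "h *\<^sub>R a + k *\<^sub>R b = h' *\<^sub>R a + k' *\<^sub>R b" and "Im (cnj a * b) \<noteq> 0"
  shows "h = h'" "k = k'"
proof -
  have "h * Re a + k * Re b = h' * Re a + k' * Re b" "h * Im a + k * Im b = h' * Im a + k' * Im b"
    using arg_cong[OF assms(1), of Re] arg_cong[OF assms(1), of Im] by simp_all
  then have "(h - h') * (Re a * Im b - Im a * Re b) = 0" "(k - k') * (Re a * Im b - Im a * Re b) = 0"
    by algebra+
  then show "h = h'" "k = k'" using assms(2) by simp_all
qed

text \<open>
  Near \<open>p\<close> the curve consists of the rays in the directions \<open>a\<close> and \<open>- b\<close> only. Hence the corners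
  in the directions \<open>a + b\<close> and \<open>- a - b\<close> are joined through the corner in the direction \<open>b - a\<close>.
\<close>

lemma closed_curve_opposite_corners:
  fixes f :: "real \<Rightarrow> complex"
  assumes cont: "continuous_on {\<alpha>..\<beta>} f" and "\<alpha> < \<beta>" and "\<eta> > 0"
    and out: "\<And>h. 0 \<le> h \<Longrightarrow> h \<le> \<eta> \<Longrightarrow> f (\<alpha> + h) = p + h *\<^sub>R a"
    and inc: "\<And>h. 0 \<le> h \<Longrightarrow> h \<le> \<eta> \<Longrightarrow> f (\<beta> - h) = p - h *\<^sub>R b"
    and once: "\<And>t. \<alpha> < t \<Longrightarrow> t < \<beta> \<Longrightarrow> f t \<noteq> p"
    and det: "Im (cnj a * b) \<noteq> 0"
  shows "\<forall>\<^sub>F \<epsilon> in at_right 0.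
    connected_component (- f ` {\<alpha>..\<beta>}) (p + \<epsilon> *\<^sub>R (a + b)) (p - \<epsilon> *\<^sub>R (a + b))"
proof -
  \<comment> \<open>The two straight ends are shortened to at most half of the interval, so that a
    middle piece is left. Its image \<open>K\<close> is compact and misses \<open>p\<close>, so that
    near \<open>p\<close> only the two rays remain.\<close>
  define \<zeta> where "\<zeta> = min \<eta> ((\<beta> - \<alpha>) / 2)"
  have \<zeta>: "\<zeta> > 0" "\<zeta> \<le> \<eta>" "\<alpha> + \<zeta> \<le> \<beta> - \<zeta>"
    using assms(2,3) by (auto simp: \<zeta>_def min_def field_simps)
  define K where "K = f ` {\<alpha> + \<zeta>..\<beta> - \<zeta>}"
  have "compact K"
    unfolding K_def using \<zeta> by (intro compact_continuous_image continuous_on_subset[OF cont]) auto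
  moreover have "p \<notin> K"
    unfolding K_def using once \<zeta> by force
  ultimately obtain \<delta> where \<delta>: "\<delta> > 0" "ball p \<delta> \<subseteq> - K"
    by (meson ComplI compact_imp_closed open_Compl open_contains_ball)
  let ?m = "norm a + norm b + 1"
  \<comment> \<open>In the coordinates \<open>(l, m)\<close> the rays are
    \<open>l \<ge> 0, m = 0\<close> and \<open>l = 0, m \<le> 0\<close>. The sides
    \<open>m = 1\<close> and \<open>l = -1\<close> of the square avoid both, and together they lead
    from \<open>(1, 1)\<close> over \<open>(-1, 1)\<close> to \<open>(-1, -1)\<close>.\<close>
  have avoid: "p + \<epsilon> *\<^sub>R (l *\<^sub>R a + m *\<^sub>R b) \<notin> f ` {\<alpha>..\<beta>}"
    if \<epsilon>: "0 < \<epsilon>" "\<epsilon> < \<delta> / ?m" and lm: "\<bar>l\<bar> \<le> 1" "\<bar>m\<bar> \<le> 1" "m = 1 \<or> l = -1" for \<epsilon> l m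
  proof
    assume "p + \<epsilon> *\<^sub>R (l *\<^sub>R a + m *\<^sub>R b) \<in> f ` {\<alpha>..\<beta>}"
    then obtain t where t: "t \<in> {\<alpha>..\<beta>}" "f t = p + \<epsilon> *\<^sub>R (l *\<^sub>R a + m *\<^sub>R b)" by (elim imageE) auto
    have "norm (l *\<^sub>R a + m *\<^sub>R b) \<le> norm a + norm b"
      using lm by (intro norm_triangle_mono) (auto simp: mult_left_le_one_le)
    then have "\<epsilon> * norm (l *\<^sub>R a + m *\<^sub>R b) \<le> \<epsilon> * ?m"
      using \<epsilon> by simp
    also have "\<dots> < \<delta>"
      using \<epsilon> by (simp add: pos_less_divide_eq add_nonneg_pos)
    finally have "f t \<in> ball p \<delta>"
      using \<epsilon> by (simp add: t(2) dist_norm)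
    then have "t \<notin> {\<alpha> + \<zeta>..\<beta> - \<zeta>}"
      using \<delta> unfolding K_def by blast
    then consider "0 \<le> t - \<alpha>" "t - \<alpha> \<le> \<eta>" | "0 \<le> \<beta> - t" "\<beta> - t \<le> \<eta>"
      using t \<zeta> by fastforce
    then show False
    proof cases
      case 1
      have "(\<epsilon> * l) *\<^sub>R a + (\<epsilon> * m) *\<^sub>R b = (t - \<alpha>) *\<^sub>R a + 0 *\<^sub>R b"
        using out[OF 1] t(2) by (simp add: algebra_simps)
      from plane_coordinates_unique[OF this det] show False
        using \<epsilon> lm(3) 1 by auto
    next
      case 2
      have "(\<epsilon> * l) *\<^sub>R a + (\<epsilon> * m) *\<^sub>R b = 0 *\<^sub>R a + (- (\<beta> - t)) *\<^sub>R b"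
        using inc[OF 2] t(2) by (simp add: algebra_simps)
      from plane_coordinates_unique[OF this det] show False
        using \<epsilon> lm(3) 2 by auto
    qed
  qed
  show ?thesis
  proof (rule eventually_at_rightI)
    show "0 < \<delta> / ?m"
      using \<delta> by (simp add: add_nonneg_pos)
    fix \<epsilon> assume "\<epsilon> \<in> {0<..<\<delta> / ?m}"
    then have \<epsilon>: "0 < \<epsilon>" "\<epsilon> < \<delta> / ?m" by auto
    let ?S = "- f ` {\<alpha>..\<beta>}"
    let ?x = "p + \<epsilon> *\<^sub>R (a + b)" and ?y = "p + \<epsilon> *\<^sub>R (b - a)" and ?z = "p - \<epsilon> *\<^sub>R (a + b)"
    have "closed_segment ?x ?y \<subseteq> ?S"
    proof
      fix q assume "q \<in> closed_segment ?x ?y"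
      then obtain u where u: "0 \<le> u" "u \<le> 1" "q = (1 - u) *\<^sub>R ?x + u *\<^sub>R ?y"
        by (auto simp: in_segment)
      then have "q = p + \<epsilon> *\<^sub>R ((1 - u - u) *\<^sub>R a + 1 *\<^sub>R b)"
        by (simp add: u(3) complex_eq_iff algebra_simps)
      then show "q \<in> ?S" using avoid[OF \<epsilon>, of "1 - u - u" 1] u by auto
    qed
    moreover have "closed_segment ?y ?z \<subseteq> ?S"
    proof
      fix q assume "q \<in> closed_segment ?y ?z"
      then obtain u where u: "0 \<le> u" "u \<le> 1" "q = (1 - u) *\<^sub>R ?y + u *\<^sub>R ?z"
        by (auto simp: in_segment)
      then have "q = p + \<epsilon> *\<^sub>R ((-1) *\<^sub>R a + (1 - u - u) *\<^sub>R b)"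
        by (simp add: u(3) complex_eq_iff algebra_simps)
      then show "q \<in> ?S" using avoid[OF \<epsilon>, of "-1" "1 - u - u"] u by auto
    qed
    ultimately have "connected_component ?S ?x ?y" "connected_component ?S ?y ?z"
      by (simp_all add: connected_componentI[OF connected_segment(1)])
    then show "connected_component ?S ?x ?z"
      by (rule connected_component_trans)
  qed
qed

lemma same_projection_crossing_param:
  assumes "vs \<in> D" "q \<in> link_points D" "fst q = fst (loop vs t)" "q \<noteq> loop vs t"
  shows "t \<in> crossing_params D vs"
proof -
  have "loop vs t \<in> link_points D" using assms(1) by (auto simp: link_points_def)
  moreover have "snd q \<noteq> snd (loop vs t)" using assms(3,4) by (simp add: prod_eq_iff)
  ultimately have "crossing D q (loop vs t) \<or> crossing D (loop vs t) q"
    using assms(2,3) by (auto simp: crossing_def)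
  then show ?thesis
    unfolding crossing_params_def under_points_def over_points_def by blast
qed

text \<open>
  The crossing splits the component into two closed curves that meet only there. Each of them
  leaves two opposite corners connected, and so does the rest of the diagram; since the curves meet in
  a connected set and the rest is disjoint from them, Janiszewski's theorem applies twice.
\<close>

lemma nugatory_figure_eight:
  assumes D: "regular_diagram D" "vs \<in> D" and cr: "crossing D (loop vs s) (loop vs r)"
    and sr: "s < r" "r < s + real (length vs)"
    and only: "\<And>q. \<lbrakk>s < q; q < s + real (length vs); q \<in> crossing_params D vs\<rbrakk> \<Longrightarrow> q = r"
  shows "nugatory D (loop vs s) (loop vs r)"
proof -
  define n f p where "n = real (length vs)" and "f = (\<lambda>t. fst (loop vs t))" and "p = fst (loop vs s)"
  let ?a = "dir vs s" and ?b = "dir vs r"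
  have pl: "polygonal_link D" using D by (simp add: regular_diagram_def)
  then have fin: "finite D" and ne: "\<And>ws. ws \<in> D \<Longrightarrow> ws \<noteq> []"
    unfolding polygonal_link_def by blast+
  have nz: "s \<notin> \<int>" "r \<notin> \<int>" "Im (cnj ?a * ?b) \<noteq> 0"
    using D cr unfolding regular_diagram_def by blast+
  then have nz': "Im (cnj ?b * ?a) \<noteq> 0" by (simp add: mult.commute)
  have per: "loop vs (t + n) = loop vs t" for t
    using loop_periodic[of vs t 1] by (simp add: n_def)
  have p: "f s = p" "f r = p" "f (s + n) = p"
    using cr per by (simp_all add: f_def p_def crossing_def)
  have lp: "loop vs t \<in> link_points D" for t
    using D(2) by (auto simp: link_points_def)
  have once: "f t \<noteq> p" if "s < t" "t < s + n" "t \<noteq> r" for t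
  proof
    assume "f t = p"
    moreover have "loop vs s \<noteq> loop vs t"
      using loop_inj[OF pl D(2), of s t] that by (auto simp: n_def)
    ultimately have "t \<in> crossing_params D vs"
      using same_projection_crossing_param[OF D(2) lp, of s t] by (simp add: f_def p_def)
    then show False using only that by (auto simp: n_def)
  qed
  have cont: "continuous_on S f" for S
    unfolding f_def by (intro continuous_intros continuous_on_loop)
  obtain \<eta>1 where \<eta>1: "\<eta>1 > 0" "\<And>h. \<bar>h\<bar> \<le> \<eta>1 \<Longrightarrow> f (s + h) = p + h *\<^sub>R ?a"
    using fst_loop_linear[OF nz(1), of vs] by (metis f_def p(1))
  obtain \<eta>2 where \<eta>2: "\<eta>2 > 0" "\<And>h. \<bar>h\<bar> \<le> \<eta>2 \<Longrightarrow> f (r + h) = p + h *\<^sub>R ?b"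
    using fst_loop_linear[OF nz(2), of vs] by (metis f_def p(2))
  define \<eta> where "\<eta> = min \<eta>1 \<eta>2"
  have \<eta>: "\<eta> > 0" "\<And>h. \<bar>h\<bar> \<le> \<eta> \<Longrightarrow> f (s + h) = p + h *\<^sub>R ?a"
    "\<And>h. \<bar>h\<bar> \<le> \<eta> \<Longrightarrow> f (r + h) = p + h *\<^sub>R ?b"
    using \<eta>1 \<eta>2 by (auto simp: \<eta>_def)
  let ?A = "f ` {s..r}" and ?B = "f ` {r..s + n}" and ?C = "fst ` (\<Union>ws\<in>D - {vs}. range (loop ws))"
  \<comment> \<open>The lobe \<open>?A\<close> leaves \<open>p\<close> along \<open>?a\<close> and
    returns along \<open>?b\<close>, the lobe \<open>?B\<close> leaves along \<open>?b\<close> and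
    returns along \<open>?a\<close>. Both keep the same pair of opposite corners connected, so one
    direction serves for both.\<close>
  let ?w = "?a + ?b"
  have A: "\<forall>\<^sub>F \<epsilon> in at_right 0. connected_component (- ?A) (p + \<epsilon> *\<^sub>R ?w) (p - \<epsilon> *\<^sub>R ?w)"
  proof (rule closed_curve_opposite_corners[OF cont sr(1) \<eta>(1) _ _ _ nz(3)])
    show "f (r - h) = p - h *\<^sub>R ?b" if "0 \<le> h" "h \<le> \<eta>" for h
      using \<eta>(3)[of "- h"] that by simp
  qed (use \<eta>(2) once sr in \<open>auto simp: n_def\<close>)
  have B: "\<forall>\<^sub>F \<epsilon> in at_right 0. connected_component (- ?B) (p + \<epsilon> *\<^sub>R (?b + ?a)) (p - \<epsilon> *\<^sub>R (?b + ?a))"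
  proof (rule closed_curve_opposite_corners[OF cont _ \<eta>(1) _ _ _ nz'])
    show "f (s + n - h) = p - h *\<^sub>R ?a" if "0 \<le> h" "h \<le> \<eta>" for h
      using \<eta>(2)[of "- h"] that per[of "s - h"] by (simp add: f_def algebra_simps)
  qed (use \<eta>(3) once sr in \<open>auto simp: n_def\<close>)
  have X: "\<sigma> \<in> {s, r, s + n}" if "\<sigma> \<in> crossing_params D vs" "s \<le> \<sigma>" "\<sigma> \<le> s + n" for \<sigma>
    using only[of \<sigma>] that by (auto simp: n_def)
  have AB: "?A \<inter> ?B = {p}"
  proof
    have "f \<sigma> = p" if "\<sigma> \<in> {s..r}" "\<tau> \<in> {r..s + n}" "f \<sigma> = f \<tau>" for \<sigma> \<tau>
    proof (cases "loop vs \<sigma> = loop vs \<tau>")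
      case True
      \<comment> \<open>The same point of the link: either the common parameter \<open>r\<close>, or
        the two ends \<open>s\<close> and \<open>s + n\<close> of the period.\<close>
      have "\<sigma> = \<tau> \<or> \<bar>\<sigma> - \<tau>\<bar> \<ge> n"
        using loop_inj[OF pl D(2) True] by (auto simp: n_def)
      then have "\<sigma> = r \<or> \<sigma> = s" using that sr by auto
      then show ?thesis using p by auto
    next
      case False
      then have "\<sigma> \<in> crossing_params D vs"
        using same_projection_crossing_param[OF D(2) lp, of \<tau> \<sigma>] that by (simp add: f_def)
      then show ?thesis using X[of \<sigma>] that sr p by (auto simp: n_def)
    qed
    then show "?A \<inter> ?B \<subseteq> {p}" by auto
    have "p \<in> ?A" "p \<in> ?B"
      by (rule image_eqI[of _ _ r]; use p sr in \<open>simp add: n_def\<close>)+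
    then show "{p} \<subseteq> ?A \<inter> ?B" by blast
  qed
  have disj: "(?A \<union> ?B) \<inter> ?C = {}"
  proof -
    have False if ws: "ws \<in> D" "ws \<noteq> vs" and \<sigma>: "s \<le> \<sigma>" "\<sigma> \<le> s + n" "f \<sigma> = fst (loop ws \<tau>)" for ws \<sigma> \<tau>
    proof -
      have other: "loop ws \<tau> \<noteq> loop vs t" for t
        using loop_eqD(1)[OF pl ws(1) D(2)] ws(2) by blast
      have q: "loop ws \<tau> \<in> link_points D" using ws by (auto simp: link_points_def)
      \<comment> \<open>A meeting with another component is a crossing, and all crossings of this
        component project to \<open>p\<close>. But two points of the component already lie above
        \<open>p\<close>, so regularity excludes a third.\<close>
      have "\<sigma> \<in> crossing_params D vs"
        using same_projection_crossing_param[OF D(2) q] \<sigma>(3) other by (simp add: f_def)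
      then have "fst (loop ws \<tau>) = p"
        using X[of \<sigma>] \<sigma> p by auto
      then have "fst (loop vs s) = fst (loop vs r) \<and> fst (loop vs r) = fst (loop ws \<tau>)"
        using p by (simp add: f_def)
      moreover have "loop vs s \<noteq> loop vs r" using cr by (auto simp: crossing_def)
      ultimately show False
        using D(1) lp q other unfolding regular_diagram_def by metis
    qed
    then have "f \<sigma> \<notin> ?C" if "s \<le> \<sigma>" "\<sigma> \<le> s + n" for \<sigma>
      using that by (simp add: image_iff) blast
    then have "f ` {s..s + n} \<inter> ?C = {}"
      unfolding disjoint_iff by (metis imageE atLeastAtMost_iff)
    moreover have "?A \<union> ?B \<subseteq> f ` {s..s + n}"
      using sr by (auto simp: n_def)
    ultimately show ?thesis by blast
  qed
  have "compact ?C"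
    using fin ne by (intro compact_continuous_image compact_UN continuous_intros compact_range_loop) auto
  have "compact ?A" "compact ?B"
    by (auto intro!: compact_continuous_image cont)
  have "p \<notin> ?C" using disj AB by blast
  then obtain \<delta> where \<delta>: "\<delta> > 0" "ball p \<delta> \<subseteq> - ?C"
    using \<open>compact ?C\<close> by (meson ComplI compact_imp_closed open_Compl open_contains_ball)
  have C: "\<forall>\<^sub>F \<epsilon> in at_right 0. connected_component (- ?C) (p + \<epsilon> *\<^sub>R ?w) (p - \<epsilon> *\<^sub>R ?w)"
  proof (rule eventually_at_rightI)
    show "0 < \<delta> / (norm ?w + 1)" using \<delta> by (simp add: add_nonneg_pos)
    fix \<epsilon> assume "\<epsilon> \<in> {0<..<\<delta> / (norm ?w + 1)}"
    then have "0 < \<epsilon>" "\<epsilon> * (norm ?w + 1) < \<delta>"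
      by (auto simp: pos_less_divide_eq add_nonneg_pos)
    then have "\<epsilon> * norm ?w < \<delta>" by (simp add: algebra_simps)
    then show "connected_component (- ?C) (p + \<epsilon> *\<^sub>R ?w) (p - \<epsilon> *\<^sub>R ?w)"
      using \<delta> \<open>0 < \<epsilon>\<close> by (intro connected_componentI[of "ball p \<delta>"]) (auto simp: dist_norm)
  qed
  have "range (loop vs) = loop vs ` {s..r} \<union> loop vs ` {r..s + n}"
    using range_loop_cbox[OF ne[OF D(2)], of s] sr
    by (simp add: n_def ivl_disj_un_two_touch flip: image_Un)
  moreover have "link_points D = range (loop vs) \<union> (\<Union>ws\<in>D - {vs}. range (loop ws))"
    using D(2) unfolding link_points_def by blast
  ultimately have "fst ` link_points D = (?A \<union> ?B) \<union> ?C"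
    by (simp add: f_def image_Un image_image)
  moreover have "\<forall>\<^sub>F \<epsilon> in at_right 0.
      connected_component (- ((?A \<union> ?B) \<union> ?C)) (p + \<epsilon> *\<^sub>R ?w) (p - \<epsilon> *\<^sub>R ?w)"
    using A B[unfolded add.commute[of ?b ?a]] C
  proof eventually_elim
    case (elim \<epsilon>)
    have "connected_component (- (?A \<union> ?B)) (p + \<epsilon> *\<^sub>R ?w) (p - \<epsilon> *\<^sub>R ?w)"
      using elim \<open>compact ?A\<close> \<open>compact ?B\<close>
      by (intro Janiszewski) (auto simp: AB compact_imp_closed)
    then show ?case
      using elim(3) \<open>compact ?A\<close> \<open>compact ?B\<close> \<open>compact ?C\<close>
      by (intro Janiszewski[of "?A \<union> ?B"]) (simp_all only: disj compact_imp_closed connected_empty compact_Un)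
  qed
  ultimately show ?thesis
    unfolding nugatory_def using D(2) cr p(1)
    by (intro bexI[of _ vs] exI[of _ s] exI[of _ r] conjI bexI[of _ ?w]) (auto simp: p_def)
qed

section \<open>Shears of the 3-sphere\<close>

lemma norm_Pair_power2: "(norm (x, y))\<^sup>2 = (norm x)\<^sup>2 + (norm y)\<^sup>2"
  by (simp add: norm_Pair)

text \<open>The distance to the pole depends on \<open>norm p\<close> only; continuity of the shears
  at the pole thus becomes a comparison of norms.\<close>

lemma north_pole_inv_stereo:
  "dist (inv_stereo p) (0, 1) = 2 / sqrt ((norm p)\<^sup>2 + 1)"
proof -
  define m where "m = (norm p)\<^sup>2 + 1"
  have m: "m > 0" by (simp add: m_def add_nonneg_pos)
  have "(norm p)\<^sup>2 - 1 = m - 2" by (simp add: m_def)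
  then have "((norm p)\<^sup>2 - 1) / m - 1 = (m - 2) / m - 1" by simp
  also have "\<dots> = - 2 / m"
    using m by (simp add: diff_divide_distrib)
  finally have "((norm p)\<^sup>2 - 1) / m - 1 = - 2 / m" .
  then have "inv_stereo p - (0, 1) = ((2 / m) *\<^sub>R p, - 2 / m)"
    by (simp add: inv_stereo_def flip: m_def)
  then have "(dist (inv_stereo p) (0, 1))\<^sup>2 = (2 / m)\<^sup>2 * (norm p)\<^sup>2 + (2 / m)\<^sup>2"
    using m by (simp only: dist_norm norm_Pair_power2) (simp add: power_mult_distrib power_divide)
  also have "\<dots> = (2 / m)\<^sup>2 * m"
    by (simp add: m_def algebra_simps)
  also have "\<dots> = (2 / sqrt m)\<^sup>2"
    using m by (simp add: power_divide power2_eq_square)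
  finally show ?thesis
    using m unfolding m_def by (subst (asm) power2_eq_iff_nonneg) auto
qed

lemma inv_stereo_in_S3: "inv_stereo p \<in> S3"
proof -
  define m where "m = (norm p)\<^sup>2 + 1"
  have m: "m > 0" by (simp add: m_def add_nonneg_pos)
  have "inv_stereo p = ((2 / m) *\<^sub>R p, ((norm p)\<^sup>2 - 1) / m)"
    by (simp add: inv_stereo_def flip: m_def)
  then have "(norm (inv_stereo p))\<^sup>2 = (4 * (norm p)\<^sup>2 + ((norm p)\<^sup>2 - 1)\<^sup>2) / m\<^sup>2"
    by (simp only: norm_Pair_power2) (simp add: power_divide power_mult_distrib add_divide_distrib)
  also have "4 * (norm p)\<^sup>2 + ((norm p)\<^sup>2 - 1)\<^sup>2 = m\<^sup>2"
    unfolding m_def by algebra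
  finally have "(norm (inv_stereo p))\<^sup>2 = 1" using m by simp
  then have "norm (inv_stereo p) = 1"
    by (simp only: power2_eq_1_iff) (smt (verit) norm_ge_zero)
  then show ?thesis by simp
qed

text \<open>At the pole the division by zero makes the value \<open>0\<close>, which has no
  geometric meaning; the pole is always treated separately.\<close>

definition stereo :: "space \<times> real \<Rightarrow> space" where
  "stereo q = (1 / (1 - snd q)) *\<^sub>R fst q"

lemma stereo_inv_stereo: "stereo (inv_stereo p) = p"
proof -
  define m where "m = (norm p)\<^sup>2 + 1"
  have m: "m > 0" by (simp add: m_def add_nonneg_pos)
  have "(norm p)\<^sup>2 - 1 = m - 2" by (simp add: m_def)
  then have "1 - ((norm p)\<^sup>2 - 1) / m = 1 - (m - 2) / m" by simp
  also have "\<dots> = 2 / m" using m by (simp add: diff_divide_distrib)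
  finally have "1 - ((norm p)\<^sup>2 - 1) / m = 2 / m" .
  then have "stereo (inv_stereo p) = (1 / (2 / m)) *\<^sub>R (2 / m) *\<^sub>R p"
    by (simp only: stereo_def inv_stereo_def fst_conv snd_conv flip: m_def)
  then show ?thesis using m by simp
qed

lemma inv_stereo_stereo:
  assumes "q \<in> S3" "q \<noteq> (0, 1)"
  shows "inv_stereo (stereo q) = q"
proof -
  obtain x h where q: "q = (x, h)" by (cases q)
  have n: "(norm x)\<^sup>2 = 1 - h\<^sup>2"
    using assms(1) norm_Pair_power2[of x h] by (simp add: q)
  have "h \<noteq> 1" using n assms(2) q by auto
  moreover have "h\<^sup>2 \<le> 1\<^sup>2" using n zero_le_power2[of "norm x"] by simp
  then have "h \<le> 1" by (rule power2_le_imp_le) simp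
  ultimately have h: "h < 1" by simp
  have "(norm (stereo q))\<^sup>2 = (1 - h\<^sup>2) / (1 - h)\<^sup>2"
    using n by (simp add: stereo_def q power_divide)
  also have "\<dots> = (1 + h) / (1 - h)"
    using h by (simp add: power2_eq_square divide_simps) (simp add: algebra_simps)
  finally have s: "(norm (stereo q))\<^sup>2 = (1 + h) / (1 - h)" .
  have "(norm (stereo q))\<^sup>2 + 1 = 2 / (1 - h)" "(norm (stereo q))\<^sup>2 - 1 = 2 * h / (1 - h)"
    unfolding s using h by (simp_all add: field_simps)
  then show ?thesis
    using h by (simp add: inv_stereo_def) (simp add: stereo_def q)
qed

lemma continuous_on_inv_stereo: "continuous_on S inv_stereo"
proof -
  have "(norm p)\<^sup>2 + 1 \<noteq> 0" for p :: space
    using zero_le_power2[of "norm p"] by linarith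
  then show ?thesis
    unfolding inv_stereo_def by (intro continuous_intros) auto
qed

lemma continuous_on_stereo: "continuous_on (S3 - {(0, 1)}) stereo"
proof -
  have "1 - snd q \<noteq> 0" if "q \<in> S3 - {(0, 1)}" for q :: "space \<times> real"
  proof
    assume "1 - snd q = 0"
    then have "snd q = 1" by simp
    moreover have "(norm (fst q))\<^sup>2 + (snd q)\<^sup>2 = 1"
      using that norm_Pair_power2[of "fst q" "snd q"] by simp
    ultimately have "fst q = 0" by simp
    with \<open>snd q = 1\<close> that show False by (cases q) auto
  qed
  then show ?thesis
    unfolding stereo_def by (intro continuous_intros) auto
qed

text \<open>This is the vertical shear \<open>(z, y) \<mapsto> (z, y - t * h z)\<close> of space,
  conjugated by stereographic projection and extended by fixing the pole.\<close>

definition sphere_shear :: "(complex \<Rightarrow> real) \<Rightarrow> real \<Rightarrow> space \<times> real \<Rightarrow> space \<times> real" where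
  "sphere_shear h t q = (if q = (0, 1) then q
     else inv_stereo (stereo q - (0, t * h (fst (stereo q)))))"

lemma inv_stereo_not_north: "inv_stereo p \<noteq> (0, 1)"
proof
  assume "inv_stereo p = (0, 1)"
  then have "2 / sqrt ((norm p)\<^sup>2 + 1) = 0"
    using north_pole_inv_stereo[of p] by simp
  then show False
    by (simp add: add_nonneg_eq_0_iff)
qed

lemma sphere_shear_inv_stereo:
  "sphere_shear h t (inv_stereo p) = inv_stereo (p - (0, t * h (fst p)))"
  by (simp add: sphere_shear_def inv_stereo_not_north stereo_inv_stereo)

lemma sphere_shear_in_S3: "q \<in> S3 \<Longrightarrow> sphere_shear h t q \<in> S3"
  using inv_stereo_in_S3 unfolding sphere_shear_def by (cases "q = (0, 1)") simp_all

text \<open>The shear preserves the projection to the plane, so \<open>h\<close> takes the same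
  value on the way back.\<close>

lemma sphere_shear_inverse:
  assumes "q \<in> S3"
  shows "sphere_shear h (- t) (sphere_shear h t q) = q"
proof (cases "q = (0, 1)")
  case False
  define p where "p = stereo q - (0, t * h (fst (stereo q)))"
  have "p - (0, - t * h (fst p)) = stereo q"
    by (simp add: p_def prod_eq_iff)
  moreover have "sphere_shear h t q = inv_stereo p"
    using False by (simp add: sphere_shear_def p_def)
  ultimately show ?thesis
    by (simp only: sphere_shear_inv_stereo inv_stereo_stereo[OF assms False])
qed (simp add: sphere_shear_def)

lemma sphere_shear_0: "q \<in> S3 \<Longrightarrow> sphere_shear h 0 q = q"
  by (auto simp: sphere_shear_def inv_stereo_stereo simp flip: zero_prod_def)

text \<open>
  Bounded translations of space change the distance to infinity, seen on the sphere, by a bounded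
  factor. This gives continuity at the north pole.
\<close>

lemma dist_north_pole_sphere_shear:
  assumes h: "\<And>z. \<bar>h z\<bar> \<le> B" and t: "\<bar>t\<bar> \<le> T" and q: "q \<in> S3"
  shows "dist (sphere_shear h t q) (0, 1) \<le> sqrt (2 + 2 * (T * B)\<^sup>2) * dist q (0, 1)"
proof (cases "q = (0, 1)")
  case True
  then show ?thesis by (simp add: sphere_shear_def)
next
  case False
  define p where "p = stereo q"
  define p' where "p' = p - (0, t * h (fst p))"
  \<comment> \<open>The shear moves \<open>p\<close> by at most \<open>T * B\<close>, hence
    \<open>(norm p)\<^sup>2 \<le> 2 * (norm p')\<^sup>2 + 2 * (T * B)\<^sup>2\<close>. After adding
    \<open>1\<close>, the factor \<open>?k\<close> covers both summands.\<close>
  let ?k = "2 + 2 * (T * B)\<^sup>2"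
  have k: "?k > 0" by (simp add: add_pos_nonneg)
  have qp: "q = inv_stereo p" using False q by (simp add: p_def inv_stereo_stereo)
  have B: "B \<ge> 0" using h[of 0] by linarith
  have "norm p \<le> norm p' + \<bar>t * h (fst p)\<bar>"
    using norm_triangle_ineq[of p' "(0, t * h (fst p))"] by (simp add: p'_def norm_Pair)
  moreover have "\<bar>t * h (fst p)\<bar> \<le> T * B"
    using mult_mono[OF t h] t by (simp add: abs_mult)
  ultimately have "(norm p)\<^sup>2 \<le> (norm p' + T * B)\<^sup>2"
    by (intro power_mono) auto
  also have "\<dots> \<le> 2 * (norm p')\<^sup>2 + 2 * (T * B)\<^sup>2"
    using sum_squares_bound[of "norm p'" "T * B"] by (simp add: power2_sum)
  finally have "(norm p)\<^sup>2 + 1 \<le> ?k * ((norm p')\<^sup>2 + 1)"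
    by (simp add: algebra_simps) (smt (verit) mult_nonneg_nonneg zero_le_power2)
  then have "sqrt ((norm p)\<^sup>2 + 1) \<le> sqrt ?k * sqrt ((norm p')\<^sup>2 + 1)"
    by (simp flip: real_sqrt_mult)
  moreover have "sqrt ((norm p)\<^sup>2 + 1) > 0" "sqrt ((norm p')\<^sup>2 + 1) > 0"
    by (simp_all add: add_nonneg_pos)
  ultimately have "2 / sqrt ((norm p')\<^sup>2 + 1) \<le> sqrt ?k * (2 / sqrt ((norm p)\<^sup>2 + 1))"
    by (simp add: divide_simps)
  then show ?thesis
    by (simp add: qp sphere_shear_inv_stereo north_pole_inv_stereo flip: p'_def)
qed

lemma continuous_on_sphere_shear:
  assumes h: "continuous_on UNIV h" "\<And>z. \<bar>h z\<bar> \<le> B"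
  shows "continuous_on (UNIV \<times> S3) (\<lambda>(t, q). sphere_shear h t q)"
proof -
  let ?F = "\<lambda>(t, q). sphere_shear h t q"
  let ?U = "UNIV \<times> (S3 - {(0, 1)}) :: (real \<times> space \<times> real) set"
  have "continuous_on ?U (\<lambda>x. stereo (snd x))"
    by (rule continuous_on_compose2[OF continuous_on_stereo]) (auto intro: continuous_intros)
  moreover from this have "continuous_on ?U (\<lambda>x. h (fst (stereo (snd x))))"
    by (intro continuous_on_compose2[OF h(1)] continuous_intros) auto
  ultimately have "continuous_on ?U (\<lambda>x. stereo (snd x) - (0, fst x * h (fst (stereo (snd x)))))"
    by (intro continuous_intros)
  then have "continuous_on ?U (\<lambda>x. inv_stereo (stereo (snd x) - (0, fst x * h (fst (stereo (snd x))))))"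
    by (rule continuous_on_compose2[OF continuous_on_inv_stereo]) auto
  then have U: "continuous_on ?U ?F"
    by (rule continuous_on_eq) (simp add: sphere_shear_def case_prod_beta mem_Times_iff)
  have "continuous (at (t, q) within UNIV \<times> S3) ?F" if q: "q \<in> S3" for t q
  proof (cases "q = (0, 1)")
    case False
    have "at (t, q) within ?U = at (t, q) within UNIV \<times> S3"
      by (rule at_within_nhd[of _ "UNIV \<times> - {(0, 1)}"]) (use False in \<open>auto intro: open_Times\<close>)
    moreover have "continuous (at (t, q) within ?U) ?F"
      using U False q by (simp add: continuous_on_eq_continuous_within)
    ultimately show ?thesis by simp
  next
    case True
    \<comment> \<open>The factor depends on the time; on the unit ball around \<open>(t, q)\<close>
      this bound makes it uniform.\<close>
    let ?T = "\<bar>t\<bar> + 1"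
    let ?k = "sqrt (2 + 2 * (?T * B)\<^sup>2)"
    have "((\<lambda>x. dist (?F x) (0, 1)) \<longlongrightarrow> 0) (at (t, q) within UNIV \<times> S3)"
    proof (rule tendsto_sandwich)
      show "\<forall>\<^sub>F x in at (t, q) within UNIV \<times> S3. 0 \<le> dist (?F x) (0, 1)"
        by simp
      have "\<forall>\<^sub>F x in at (t, q) within UNIV \<times> S3. x \<in> UNIV \<times> S3 \<and> dist x (t, q) < 1"
        by (auto simp: eventually_at intro!: exI[of _ 1])
      then show "\<forall>\<^sub>F x in at (t, q) within UNIV \<times> S3. dist (?F x) (0, 1) \<le> ?k * dist (snd x) (0, 1)"
      proof eventually_elim
        case (elim x)
        have "dist (fst x) t < 1"
          using elim dist_fst_le[of x "(t, q)"] by simp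
        then have "\<bar>fst x\<bar> \<le> ?T" by (simp add: dist_real_def)
        from dist_north_pole_sphere_shear[OF h(2) this] elim
        show ?case by (auto simp: case_prod_beta)
      qed
      have "((\<lambda>x. ?k * dist (snd x) (0, 1)) \<longlongrightarrow> ?k * dist (snd (t, q)) (0, 1)) (at (t, q) within UNIV \<times> S3)"
        by (intro tendsto_intros)
      then show "((\<lambda>x. ?k * dist (snd x) (0, 1)) \<longlongrightarrow> 0) (at (t, q) within UNIV \<times> S3)"
        by (simp add: True)
    qed auto
    then have "(?F \<longlongrightarrow> (0, 1)) (at (t, q) within UNIV \<times> S3)"
      by (rule tendsto_dist_iff[THEN iffD2])
    then show ?thesis
      by (simp add: continuous_within True sphere_shear_def)
  qed
  then show ?thesis
    by (auto simp: continuous_on_eq_continuous_within)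
qed

text \<open>The isotopies run simultaneously, \<open>K t\<close> after \<open>H t\<close>, which
  avoids gluing them at an intermediate time.\<close>

lemma ambient_isotopic_trans:
  assumes "ambient_isotopic A B" "ambient_isotopic B C"
  shows "ambient_isotopic A C"
proof -
  obtain H :: "real \<Rightarrow> space \<times> real \<Rightarrow> space \<times> real" where H: "continuous_on ({0..1} \<times> S3) (\<lambda>(t, x). H t x)"
     "\<forall>t\<in>{0..1}. \<exists>g. homeomorphism S3 S3 (H t) g" "\<forall>x\<in>S3. H 0 x = x" "H 1 ` A = B"
    using assms(1) unfolding ambient_isotopic_def by (elim exE conjE) (rule that, assumption+)
  obtain K :: "real \<Rightarrow> space \<times> real \<Rightarrow> space \<times> real" where K: "continuous_on ({0..1} \<times> S3) (\<lambda>(t, x). K t x)"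
     "\<forall>t\<in>{0..1}. \<exists>g. homeomorphism S3 S3 (K t) g" "\<forall>x\<in>S3. K 0 x = x" "K 1 ` B = C"
    using assms(2) unfolding ambient_isotopic_def by (elim exE conjE) (rule that, assumption+)
  have im: "H t x \<in> S3" if "t \<in> {0..1}" "x \<in> S3" for t x
  proof -
    from bspec[OF H(2) that(1)] obtain g where "homeomorphism S3 S3 (H t) g" ..
    then have "H t ` S3 = S3" by (rule homeomorphism_image1)
    then show ?thesis using that(2) by blast
  qed
  have "continuous_on ({0..1} \<times> S3) (\<lambda>x. (fst x, H (fst x) (snd x)))"
    by (rule continuous_on_Pair[OF continuous_on_fst[OF continuous_on_id] H(1)[unfolded case_prod_beta]])
  moreover have "(\<lambda>x. (fst x, H (fst x) (snd x))) ` ({0..1} \<times> S3) \<subseteq> {0..1} \<times> S3"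
    by (rule image_subsetI) (simp only: mem_Times_iff fst_conv snd_conv im simp_thms)
  ultimately have "continuous_on ({0..1} \<times> S3) (\<lambda>x. case (fst x, H (fst x) (snd x)) of (t, x) \<Rightarrow> K t x)"
    by (rule continuous_on_compose2[OF K(1)])
  then have "continuous_on ({0..1} \<times> S3) (\<lambda>(t, x). K t (H t x))"
    by (simp only: case_prod_unfold fst_conv snd_conv)
  moreover have "\<forall>t\<in>{0..1}. \<exists>g. homeomorphism S3 S3 (\<lambda>x. K t (H t x)) g"
  proof
    fix t :: real assume t: "t \<in> {0..1}"
    from bspec[OF H(2) t] obtain g where g: "homeomorphism S3 S3 (H t) g" ..
    from bspec[OF K(2) t] obtain g' where g': "homeomorphism S3 S3 (K t) g'" ..
    from homeomorphism_compose[OF g g'] show "\<exists>g. homeomorphism S3 S3 (\<lambda>x. K t (H t x)) g"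
      unfolding comp_def by (rule exI[of _ "\<lambda>x. g (g' x)"])
  qed
  moreover have "\<forall>x\<in>S3. K 0 (H 0 x) = x"
    by (intro ballI) (simp only: bspec[OF H(3)] bspec[OF K(3)])
  moreover have "(\<lambda>x. K 1 (H 1 x)) ` A = C"
    unfolding H(4)[symmetric] K(4)[symmetric] by (simp only: image_image)
  ultimately show ?thesis
    unfolding ambient_isotopic_def by (intro exI[of _ "\<lambda>t x. K t (H t x)"] conjI)
qed

text \<open>The factor \<open>t\<close> is the time of the isotopy: time \<open>0\<close> is the
  identity, and the shear with \<open>- t\<close> inverts the one with \<open>t\<close>.\<close>

lemma ambient_isotopic_sphere_shear:
  assumes h: "continuous_on UNIV h" "\<And>z. \<bar>h z\<bar> \<le> B"
  shows "ambient_isotopic A (sphere_shear h 1 ` A)"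
proof -
  note cont = continuous_on_sphere_shear[OF h]
  have slice: "continuous_on S3 (sphere_shear h t)" for t
  proof -
    have "continuous_on S3 (Pair t)"
      by (intro continuous_on_Pair continuous_on_const continuous_on_id)
    from continuous_on_compose2[OF cont this] show ?thesis by auto
  qed
  have "homeomorphism S3 S3 (sphere_shear h t) (sphere_shear h (- t))" for t
    using sphere_shear_inverse[of _ h t] sphere_shear_inverse[of _ h "- t"]
    by (intro homeomorphismI slice) (auto simp only: sphere_shear_in_S3 minus_minus image_subset_iff)
  moreover have "continuous_on ({0..1} \<times> S3) (\<lambda>(t, q). sphere_shear h t q)"
    by (rule continuous_on_subset[OF cont]) auto
  moreover have "\<forall>q\<in>S3. sphere_shear h 0 q = q"
    using sphere_shear_0 by blast
  ultimately show ?thesis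
    unfolding ambient_isotopic_def by (intro exI[of _ "sphere_shear h"]) blast
qed

text \<open>Since the projection is injective on the link, coincidences of the flattened curves lift
  to coincidences on the polygonal link, where they are excluded up to the period.\<close>

lemma is_link_flat_projection:
  assumes pl: "polygonal_link D" and inj: "inj_on fst (link_points D)"
  shows "is_link (inv_stereo ` (\<lambda>p. (fst p, 0)) ` link_points D)"
proof -
  define \<gamma> where "\<gamma> vs x = inv_stereo (fst (loop vs (x * real (length vs))), 0)" for vs x
  have fin: "finite D" "D \<noteq> {}" and ne: "\<And>vs. vs \<in> D \<Longrightarrow> length vs > 0"
    using pl unfolding polygonal_link_def by auto
  have \<gamma>_eq: "loop vs (x * real (length vs)) = loop ws (y * real (length ws))"
    if "vs \<in> D" "ws \<in> D" "\<gamma> vs x = \<gamma> ws y" for vs ws x y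
  proof -
    have "fst (loop vs (x * real (length vs))) = fst (loop ws (y * real (length ws)))"
      using arg_cong[OF that(3), of stereo] by (simp add: \<gamma>_def stereo_inv_stereo)
    then show ?thesis
      using inj that(1,2) by (auto simp: inj_on_def link_points_def)
  qed
  have cont: "continuous_on S (\<gamma> vs)" for S vs
    unfolding \<gamma>_def
    by (intro continuous_on_compose2[OF continuous_on_inv_stereo[of UNIV]]
        continuous_on_compose2[OF continuous_on_loop[of UNIV]] continuous_intros) auto
  have image: "path_image (\<gamma> vs) = inv_stereo ` (\<lambda>p. (fst p, 0)) ` range (loop vs)" if "vs \<in> D" for vs
  proof -
    have times_commute_fun: "(\<lambda>x. x * real (length vs)) = (*) (real (length vs))"
      by (simp add: fun_eq_iff)
    have "{0..real (length vs)} = (\<lambda>x. x * real (length vs)) ` {0..1}"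
      unfolding times_commute_fun
      using image_mult_atLeastAtMost[of "real (length vs)" 0 1] ne[OF that] by simp
    then show ?thesis
      using range_loop_cbox[of vs 0] ne[OF that]
      by (simp add: path_image_def image_image \<gamma>_def)
  qed
  have "simple_path (\<gamma> vs)" if "vs \<in> D" for vs
    unfolding simple_path_def loop_free_def
  proof (intro conjI ballI impI)
    show "path (\<gamma> vs)" by (simp add: path_def cont)
    fix x y :: real assume xy: "x \<in> {0..1}" "y \<in> {0..1}" "\<gamma> vs x = \<gamma> vs y"
    show "x = y \<or> x = 0 \<and> y = 1 \<or> x = 1 \<and> y = 0"
    proof (cases "\<bar>x - y\<bar> < 1")
      case True
      then have "\<bar>x * real (length vs) - y * real (length vs)\<bar> < real (length vs)"
        using ne[OF that] by (simp add: abs_mult flip: left_diff_distrib)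
      then show ?thesis
        using loop_inj[OF pl that \<gamma>_eq[OF that that xy(3)]] ne[OF that] by simp
    qed (use xy in auto)
  qed
  moreover have "pathfinish (\<gamma> vs) = pathstart (\<gamma> vs)" for vs
    using loop_periodic[of vs 0 1] by (simp add: pathfinish_def pathstart_def \<gamma>_def)
  moreover have "path_image (\<gamma> vs) \<subseteq> S3" for vs
    using inv_stereo_in_S3 by (auto simp only: path_image_def \<gamma>_def)
  moreover have "pairwise (\<lambda>g h. path_image g \<inter> path_image h = {}) (\<gamma> ` D)"
    unfolding pairwise_def
  proof clarify
    fix vs ws assume "vs \<in> D" "ws \<in> D" "\<gamma> vs \<noteq> \<gamma> ws"
    then have "\<gamma> vs x \<noteq> \<gamma> ws y" for x y
      using \<gamma>_eq loop_eqD(1)[OF pl] by blast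
    then show "path_image (\<gamma> vs) \<inter> path_image (\<gamma> ws) = {}"
      unfolding path_image_def disjoint_iff by (metis imageE)
  qed
  moreover have "inv_stereo ` (\<lambda>p. (fst p, 0)) ` link_points D = (\<Union>g\<in>\<gamma> ` D. path_image g)"
    using image by (simp add: link_points_def image_UN)
  ultimately show ?thesis
    unfolding is_link_def using fin by (intro exI[of _ "\<gamma> ` D"]) auto
qed

text \<open>
  The link is the graph of a height function over its projection. Subtracting a bounded continuous
  extension of this function from the height flattens the link.
\<close>

lemma trivial_link_injective_projection:
  assumes pl: "polygonal_link D" and inj: "inj_on fst (link_points D)"
    and L: "ambient_isotopic L (inv_stereo ` link_points D)"
  shows "trivial_link L"
proof -
  let ?N = "link_points D" and ?flat = "\<lambda>p::space. (fst p, 0::real)"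
  have "compact ?N" using pl by (rule compact_link_points)
  moreover have "continuous_on ?N fst" by (intro continuous_on_fst continuous_on_id)
  ultimately obtain g where g: "homeomorphism ?N (fst ` ?N) fst g"
    using homeomorphism_compact[OF _ _ HOL.refl inj] by blast
  have K: "compact (fst ` ?N)"
    using \<open>compact ?N\<close> by (intro compact_continuous_image continuous_intros)
  have cg: "continuous_on (fst ` ?N) (\<lambda>z. snd (g z))"
    using g by (intro continuous_intros) (simp add: homeomorphism_def)
  have "bounded ((\<lambda>z. snd (g z)) ` fst ` ?N)"
    by (rule compact_imp_bounded[OF compact_continuous_image[OF cg K]])
  then obtain B where B: "0 < B" "\<And>z. z \<in> fst ` ?N \<Longrightarrow> norm (snd (g z)) \<le> B"
    by (auto simp: bounded_pos)
  \<comment> \<open>Compactness makes the inverse \<open>g\<close> of the projection continuous, so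
    Tietze applies to the height. The extension keeps the bound \<open>B\<close>, which the estimate
    at the pole uses.\<close>
  obtain h where h: "continuous_on UNIV h" "\<And>z. z \<in> fst ` ?N \<Longrightarrow> h z = snd (g z)"
    "\<And>z. z \<in> UNIV \<Longrightarrow> norm (h z) \<le> B"
    using Tietze[OF cg, of UNIV B] B K by (auto simp: compact_imp_closed)
  have "sphere_shear h 1 (inv_stereo p) = inv_stereo (?flat p)" if "p \<in> ?N" for p
  proof -
    have "h (fst p) = snd p"
      using h(2) g that by (simp add: homeomorphism_def)
    then have "p - (0, h (fst p)) = ?flat p" by (simp add: prod_eq_iff)
    then show ?thesis by (simp add: sphere_shear_inv_stereo)
  qed
  then have "sphere_shear h 1 ` inv_stereo ` ?N = inv_stereo ` ?flat ` ?N"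
    by (auto simp: image_image)
  then have "ambient_isotopic L (inv_stereo ` ?flat ` ?N)"
    using ambient_isotopic_trans[OF L ambient_isotopic_sphere_shear[OF h(1), of B]] h(3) by simp
  moreover have "inv_stereo ` ?flat ` ?N \<subseteq> inv_stereo ` {p. snd p = 0}"
    by auto
  ultimately show ?thesis
    unfolding trivial_link_def using is_link_flat_projection[OF pl inj] by blast
qed

section \<open>Arcs of alternating diagrams\<close>

lemma next_crossing_over:
  assumes D: "regular_diagram D" "alternating_diagram D" "vs \<in> D" and s: "loop vs s \<in> under_points D"
  obtains r where "s < r" "r \<le> s + real (length vs)" "loop vs r \<in> over_points D"
    "\<And>q. \<lbrakk>s < q; q < r\<rbrakk> \<Longrightarrow> q \<notin> crossing_params D vs"
proof -
  have "s \<in> crossing_params D vs" using s by (simp add: crossing_params_def)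
  then obtain r where r: "r \<in> crossing_params D vs" "s < r" "r \<le> s + real (length vs)"
    "\<And>q. \<lbrakk>s < q; q < r\<rbrakk> \<Longrightarrow> q \<notin> crossing_params D vs"
    using next_crossing_param[OF D(1,3)] by blast
  then have "loop vs s \<in> under_points D \<longleftrightarrow> loop vs r \<in> over_points D"
    using D(2,3) s unfolding alternating_diagram_def crossing_params_def by blast
  then show thesis using that r s by blast
qed

lemma previous_crossing_over:
  assumes D: "regular_diagram D" "alternating_diagram D" "vs \<in> D" and s: "loop vs s \<in> under_points D"
  obtains r where "r < s" "s - real (length vs) \<le> r" "loop vs r \<in> over_points D"
    "\<And>q. \<lbrakk>r < q; q < s\<rbrakk> \<Longrightarrow> q \<notin> crossing_params D vs"
proof -
  have "s \<in> crossing_params D vs" using s by (simp add: crossing_params_def)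
  then obtain r where r: "r \<in> crossing_params D vs" "r < s" "s - real (length vs) \<le> r"
    "\<And>q. \<lbrakk>r < q; q < s\<rbrakk> \<Longrightarrow> q \<notin> crossing_params D vs"
    using previous_crossing_param[OF D(1,3)] by blast
  then have "loop vs r \<in> under_points D \<longleftrightarrow> loop vs s \<in> over_points D"
    using D(2,3) s unfolding alternating_diagram_def crossing_params_def by blast
  \<comment> \<open>\<open>s\<close> is under and hence not over, so \<open>r\<close> is not under;
    being a crossing, it is over.\<close>
  then show thesis
    using that r s under_over_disjoint[OF D(1)] by (auto simp: crossing_params_def)
qed

lemma next_crossing_under:
  assumes D: "regular_diagram D" "alternating_diagram D" "vs \<in> D" and s: "loop vs s \<in> over_points D"
  obtains r where "s < r" "r \<le> s + real (length vs)" "loop vs r \<in> under_points D"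
    "\<And>q. \<lbrakk>s < q; q < r\<rbrakk> \<Longrightarrow> q \<notin> crossing_params D vs"
proof -
  have "s \<in> crossing_params D vs" using s by (simp add: crossing_params_def)
  then obtain r where r: "r \<in> crossing_params D vs" "s < r" "r \<le> s + real (length vs)"
    "\<And>q. \<lbrakk>s < q; q < r\<rbrakk> \<Longrightarrow> q \<notin> crossing_params D vs"
    using next_crossing_param[OF D(1,3)] by blast
  then have "loop vs s \<in> under_points D \<longleftrightarrow> loop vs r \<in> over_points D"
    using D(2,3) s unfolding alternating_diagram_def crossing_params_def by blast
  moreover have "loop vs s \<notin> under_points D"
    using under_over_disjoint[OF D(1)] s by blast
  ultimately have "loop vs r \<in> under_points D"
    using r(1) by (simp add: crossing_params_def)
  then show thesis using that r by blast
qed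

text \<open>It is empty at an undercrossing; overcrossings never fall into this case.\<close>

definition arc_at :: "space list set \<Rightarrow> space \<Rightarrow> space set" where
  "arc_at D p = connected_component_set (link_points D - under_points D) p"

lemma arc_at:
  assumes "regular_diagram D" "p \<in> over_points D"
  shows "p \<in> arc_at D p" "arc_at D p \<in> arcs D"
proof -
  have "p \<in> link_points D - under_points D"
    using assms(2) under_over_disjoint[OF assms(1)] unfolding over_points_def crossing_def by blast
  then show "p \<in> arc_at D p" "arc_at D p \<in> arcs D"
    by (auto simp: arc_at_def arcs_def components_def)
qed

lemma loop_connected_in_arc_at:
  assumes "vs \<in> D" "connected I" "r \<in> I" "t \<in> I" "\<And>q. q \<in> I \<Longrightarrow> loop vs q \<notin> under_points D"
  shows "loop vs t \<in> arc_at D (loop vs r)"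
proof -
  have "loop vs ` I \<subseteq> link_points D - under_points D"
    using assms by (auto simp: link_points_def)
  moreover have "connected (loop vs ` I)"
    using assms(2) by (intro connected_continuous_image continuous_on_loop)
  ultimately show ?thesis
    using assms(3,4) unfolding arc_at_def
    by (metis connected_component_maximal image_eqI subsetD)
qed

text \<open>The closed piece from \<open>s\<close> to \<open>s'\<close> and the closed remainder of the link share undercrossings only.\<close>

lemma arc_at_subset_between_unders:
  assumes D: "regular_diagram D" "vs \<in> D" and r: "s < r" "r < s'" "s' \<le> s + real (length vs)"
    and u: "loop vs s \<in> under_points D" "loop vs s' \<in> under_points D"
  shows "arc_at D (loop vs r) \<subseteq> loop vs ` {s<..<s'}"
proof -
  define I where "I = loop vs ` {s'..s + real (length vs)}"
  define C where "C = (\<Union>ws\<in>D - {vs}. range (loop ws))"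
  define J where "J = loop vs ` {s..s'}"
  define S where "S = arc_at D (loop vs r)"
  have pl: "polygonal_link D" using D by (simp add: regular_diagram_def)
  then have fin: "finite D" and ne: "\<And>ws. ws \<in> D \<Longrightarrow> ws \<noteq> []"
    unfolding polygonal_link_def by blast+
  have sub: "S \<subseteq> link_points D - under_points D"
    unfolding S_def arc_at_def by (rule connected_component_subset)
  have "closed C"
    unfolding C_def using fin ne by (intro compact_imp_closed compact_UN compact_range_loop) simp_all
  moreover have "closed J" "closed I"
    unfolding I_def J_def
    by (intro compact_imp_closed[OF compact_continuous_image[OF continuous_on_loop compact_Icc]])+
  ultimately have cl: "closed J" "closed (I \<union> C)"
    by (simp_all add: closed_Un)
  have "{s..s + real (length vs)} = {s..s'} \<union> {s'..s + real (length vs)}"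
    using r by (simp add: ivl_disj_un_two_touch)
  then have "range (loop vs) = J \<union> I"
    using range_loop_cbox[OF ne[OF D(2)], of s] by (simp add: I_def J_def flip: image_Un)
  moreover have "link_points D = range (loop vs) \<union> C"
    using D(2) unfolding link_points_def C_def by blast
  ultimately have cover: "S \<subseteq> J \<union> (I \<union> C)"
    using sub by blast
  have "loop vs q \<in> under_points D" if q: "q \<in> {s..s'}" "loop vs q \<in> I \<union> C" for q
  proof -
    have "loop vs q \<notin> C"
      unfolding C_def using loop_eqD(1)[OF pl D(2)] by blast
    then obtain q' where q': "q' \<in> {s'..s + real (length vs)}" "loop vs q = loop vs q'"
      using q(2) unfolding I_def by blast
    then have "q = q' \<or> \<bar>q - q'\<bar> \<ge> real (length vs)"
      using loop_inj[OF pl D(2) q'(2)] by force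
    then have "q = s' \<or> q = s"
      using q' q(1) by auto
    then show ?thesis using u by blast
  qed
  then have disj: "J \<inter> (I \<union> C) \<inter> S = {}"
    using sub unfolding J_def by blast
  have conn: "connected S" by (simp add: S_def arc_at_def)
  have "w \<in> loop vs ` {s<..<s'}" if w: "w \<in> S" for w
  proof -
    have "loop vs r \<in> link_points D - under_points D"
      using w connected_component_in unfolding S_def arc_at_def by fast
    then have "loop vs r \<in> S"
      by (simp add: S_def arc_at_def connected_component_refl)
    moreover have "loop vs r \<in> J"
      unfolding J_def using r by (intro imageI) simp
    ultimately have "(I \<union> C) \<inter> S = {}"
      using connected_closedD[OF conn disj cover cl] by blast
    then have "w \<in> J" using cover w by blast
    then obtain q where q: "q \<in> {s..s'}" "w = loop vs q"
      unfolding J_def by (rule imageE)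
    have "w \<notin> under_points D" using sub w by blast
    then have "q \<noteq> s" "q \<noteq> s'" using q(2) u by blast+
    then show ?thesis using q by (intro image_eqI[of _ _ q]) simp_all
  qed
  then show ?thesis unfolding S_def by (rule subsetI)
qed

theorem theorem8p1:
  fixes L :: "(space \<times> real) set" and D :: "space list set"
  assumes "tame_link L"
    and "\<not> trivial_link L"
    and "alternating_link L"
    and "diagram_of D L"
    and "reduced_diagram D"
    and "alternating_diagram D"
    and "inj_on (IQ_generator D) (arcs D)"
  shows "\<not> left_orderable (IQ D)"
proof
  assume "left_orderable (IQ D)"
  then obtain R where R: "strict_linear_order_on (qcarrier (IQ D)) R"
    and mono: "\<forall>x\<in>qcarrier (IQ D). \<forall>y\<in>qcarrier (IQ D). \<forall>z\<in>qcarrier (IQ D).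
        (x, y) \<in> R \<longrightarrow> (qop (IQ D) z x, qop (IQ D) z y) \<in> R"
    unfolding left_orderable_def by blast
  have D: "regular_diagram D" and iso: "ambient_isotopic L (inv_stereo ` link_points D)"
    using assms(4) by (auto simp: diagram_of_def)
  then have pl: "polygonal_link D" by (simp add: regular_diagram_def)
  note alt = D assms(6)
  define M where "M = IQ_generator D ` arc_at D ` over_points D"
  have "\<not> inj_on fst (link_points D)"
    using trivial_link_injective_projection[OF pl _ iso] assms(2) by blast
  then obtain p q where "p \<in> link_points D" "q \<in> link_points D" "fst p = fst q" "p \<noteq> q"
    unfolding inj_on_def by blast
  moreover from this have "snd p \<noteq> snd q"
    by (simp add: prod_eq_iff)
  then have "snd p < snd q \<or> snd q < snd p"
    by linarith
  ultimately have "crossing D p q \<or> crossing D q p"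
    by (simp add: crossing_def)
  then have ne: "M \<noteq> {}"
    unfolding M_def over_points_def by blast
  have fin: "finite M"
    unfolding M_def by (intro finite_imageI finite_over_points D)
  have tr: "trans R" and ir: "irrefl R"
    using R by (simp_all add: strict_linear_order_on_def)
  have tM: "transp_on M (\<lambda>x y. (x, y) \<in> R)"
    by (rule transp_onI) (rule transD[OF tr])
  have aM: "asymp_on M (\<lambda>x y. (x, y) \<in> R)"
  proof (rule asymp_onI, rule notI)
    fix x y assume "(x, y) \<in> R" "(y, x) \<in> R"
    then have "(x, x) \<in> R" by (rule transD[OF tr])
    then show False using irreflD[OF ir] by simp
  qed
  from Finite_Set.bex_min_element[OF fin aM tM ne]
  obtain m where "m \<in> M" and "\<forall>x\<in>M. x \<noteq> m \<longrightarrow> (x, m) \<notin> R" ..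
  then have m: "(x, m) \<notin> R" if "x \<in> M" for x
    using irreflD[OF ir] that by (cases "x = m") simp_all
  from \<open>m \<in> M\<close>
  obtain v where v: "v \<in> over_points D" "m = IQ_generator D (arc_at D v)"
    by (auto simp: M_def)
  then obtain u where cr: "crossing D u v" by (auto simp: over_points_def)
  then have "u \<in> link_points D" "v \<in> link_points D" by (auto simp: crossing_def)
  then obtain vs ws s t where vs: "vs \<in> D" "u = loop vs s" and ws: "ws \<in> D" "v = loop ws t"
    unfolding link_points_def by blast
  let ?n = "real (length vs)"
  have us: "loop vs s \<in> under_points D"
    using cr vs by (auto simp only: under_points_def)
  have u_params: "q \<in> crossing_params D vs" if "loop vs q \<in> under_points D" for q
    using that by (simp add: crossing_params_def)
  \<comment> \<open>Alternation gives the pattern over \<open>r'\<close>, under \<open>s\<close>,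
    over \<open>r\<close>, under \<open>s'\<close>. So the arcs on both sides of \<open>s\<close>
    contain overcrossings, and their generators lie in \<open>M\<close>, where \<open>m\<close> is
    minimal.\<close>
  obtain r where r: "s < r" "r \<le> s + ?n" "loop vs r \<in> over_points D"
    "\<And>q. \<lbrakk>s < q; q < r\<rbrakk> \<Longrightarrow> q \<notin> crossing_params D vs"
    using next_crossing_over[OF alt vs(1) us] by blast
  obtain r' where r': "r' < s" "s - ?n \<le> r'" "loop vs r' \<in> over_points D"
    "\<And>q. \<lbrakk>r' < q; q < s\<rbrakk> \<Longrightarrow> q \<notin> crossing_params D vs"
    using previous_crossing_over[OF alt vs(1) us] by blast
  obtain s' where s': "r < s'" "s' \<le> r + ?n" "loop vs s' \<in> under_points D"
    "\<And>q. \<lbrakk>r < q; q < s'\<rbrakk> \<Longrightarrow> q \<notin> crossing_params D vs"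
    using next_crossing_under[OF alt vs(1) r(3)] by blast
  have over_not_under: "loop vs q \<notin> under_points D" if "loop vs q \<in> over_points D" for q
    using under_over_disjoint[OF D] that by blast
  define x y z where "x = arc_at D (loop vs r')" and "y = arc_at D v" and "z = arc_at D (loop vs r)"
  have arcs: "x \<in> arcs D" "y \<in> arcs D" "z \<in> arcs D"
    using arc_at(2)[OF D] v(1) r(3) r'(3) by (simp_all add: x_def y_def z_def)
  have "loop vs q \<in> x" if "r' \<le> q" "q < s" for q
    unfolding x_def
  proof (rule loop_connected_in_arc_at[OF vs(1), of "{r'..<s}"])
    show "loop vs q' \<notin> under_points D" if "q' \<in> {r'..<s}" for q'
      using that r'(4)[of q'] u_params over_not_under[OF r'(3)] by (cases "q' = r'") auto
  qed (use that r' in auto)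
  then have incoming: "\<forall>\<^sub>F \<epsilon> in at_right 0. loop vs (s - \<epsilon>) \<in> x"
    using r'(1) by (intro eventually_at_rightI[of 0 "s - r'"]) auto
  have "loop vs q \<in> z" if "s < q" "q \<le> r" for q
    unfolding z_def
  proof (rule loop_connected_in_arc_at[OF vs(1), of "{s<..r}"])
    show "loop vs q' \<notin> under_points D" if "q' \<in> {s<..r}" for q'
      using that r(4)[of q'] u_params over_not_under[OF r(3)] by (cases "q' = r") auto
  qed (use that r in auto)
  then have outgoing: "\<forall>\<^sub>F \<epsilon> in at_right 0. loop vs (s + \<epsilon>) \<in> z"
    using r(1) by (intro eventually_at_rightI[of 0 "r - s"]) auto
  have over: "loop ws t \<in> y"
    using arc_at(1)[OF D v(1)] by (simp add: y_def ws)
  have "crossing D (loop vs s) (loop ws t)"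
    using cr vs ws by simp
  then have "(Gen z, if Im (cnj (dir ws t) * dir vs s) > 0 then Op (Gen x) (Gen y)
      else Inv (Gen x) (Gen y)) \<in> crossing_relations D"
    unfolding crossing_relations_def
    by (intro CollectI exI[of _ x] exI[of _ y] exI[of _ z] exI[of _ vs] exI[of _ ws]
        exI[of _ s] exI[of _ t] conjI HOL.refl arcs vs(1) ws(1) over incoming outgoing)
  note IQ_crossing_relation[OF arcs this]
  from left_order_involutory_triple[OF quandle_IQ R mono IQ_generator_carrier[OF arcs(1)]
      IQ_generator_carrier[OF arcs(2)] IQ_generator_carrier[OF arcs(3)] this] arcs(1)
  have "IQ_generator D x = IQ_generator D y \<and> IQ_generator D z = IQ_generator D y
      \<or> (IQ_generator D x, m) \<in> R \<or> (IQ_generator D z, m) \<in> R"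
    unfolding v(2) y_def by blast
  moreover have "IQ_generator D x \<in> M" "IQ_generator D z \<in> M"
    using r(3) r'(3) by (simp_all add: M_def x_def z_def)
  ultimately have "IQ_generator D x = IQ_generator D y" "IQ_generator D z = IQ_generator D y"
    using m by blast+
  then have eq: "x = y" "z = y"
    using assms(7) arcs by (auto dest: inj_onD)
  \<comment> \<open>The undercrossing \<open>s\<close> recurs at \<open>s + ?n\<close>, so the first
    undercrossing after \<open>r\<close> comes no later.\<close>
  have "s' \<le> s + ?n"
  proof (rule ccontr)
    assume "\<not> s' \<le> s + ?n"
    moreover have sn: "loop vs (s + ?n) \<in> under_points D"
      using us loop_periodic[of vs s 1] by simp
    moreover have "r \<noteq> s + ?n" using sn over_not_under[OF r(3)] by auto
    ultimately show False
      using s'(4)[of "s + ?n"] u_params r(2) by auto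
  qed
  then have y_sub: "y \<subseteq> loop vs ` {s<..<s'}"
    using arc_at_subset_between_unders[OF D vs(1) r(1) s'(1) _ us s'(3)] eq by (simp add: z_def)
  have only: "q = r" if "q \<in> {s<..<s'}" "loop vs q \<in> over_points D" for q
    using that r(4)[of q] s'(4)[of q] by (cases q r rule: linorder_cases) (auto simp: crossing_params_def)
  have in_y: "w = loop vs r" if "w \<in> y" "w \<in> over_points D" for w
    using y_sub that only by blast
  have "loop vs r' \<in> y"
    using arc_at(1)[OF D r'(3)] eq by (simp add: x_def)
  then have r'r: "loop vs r' = loop vs r"
    using in_y r'(3) by blast
  then obtain k :: int where k: "r = r' + of_int k * ?n"
    using loop_eqD(2)[OF pl vs(1) vs(1)] by blast
  \<comment> \<open>The over arc \<open>y\<close> equals \<open>z\<close>, whose only overcrossing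
    is at \<open>r\<close>. So the strand above \<open>u\<close> belongs to the same
    component.\<close>
  have "v = loop vs r"
    using in_y arc_at(1)[OF D v(1)] v(1) by (simp add: y_def)
  have n: "?n > 0" using pl vs(1) by (auto simp: polygonal_link_def)
  have "r < s + ?n"
    using r(2) us loop_periodic[of vs s 1] over_not_under[OF r(3)] by (cases "r = s + ?n") auto
  \<comment> \<open>From \<open>s - ?n \<le> r'\<close>, \<open>r' < s\<close>, \<open>s < r\<close>
    and \<open>r < s + ?n\<close> the difference \<open>r - r'\<close> lies strictly between
    \<open>0\<close> and two periods, so it is exactly one.\<close>
  then have "of_int k * ?n < 2 * ?n" "0 * ?n < of_int k * ?n"
    using k r' r by auto
  then have "of_int k < (2::real)" "(0::real) < of_int k"
    using n by (simp_all only: mult_less_cancel_right_pos)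
  then have "k = 1" by linarith
  have "nugatory D (loop vs s) (loop vs r)"
  proof (rule nugatory_figure_eight[OF D vs(1) _ r(1) \<open>r < s + ?n\<close>])
    show "crossing D (loop vs s) (loop vs r)"
      using cr vs \<open>v = loop vs r\<close> by simp
    fix q assume q: "s < q" "q < s + ?n" "q \<in> crossing_params D vs"
    show "q = r"
    proof (rule ccontr)
      assume "q \<noteq> r"
      then have "r < q" using q r(4)[of q] by force
      \<comment> \<open>Since \<open>r' = r - ?n\<close>, a crossing between \<open>r\<close> and
        \<open>s + ?n\<close> shifts back to one between \<open>r'\<close> and \<open>s\<close>,
        where there is none.\<close>
      then have "r' < q - ?n" "q - ?n < s" using q k \<open>k = 1\<close> by auto
      then show False
        using r'(4)[of "q - ?n"] q(3) by (simp add: crossing_params_periodic)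
    qed
  qed
  then show False
    using assms(5) cr vs \<open>v = loop vs r\<close> unfolding reduced_diagram_def by blast
qed

end
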